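(* Let $f,g,h\in L^1_{\mathrm{loc}}(\mathbb{R})$ be arbitrary, set $F=-e^{Pg}f$, $H=e^{-Pg}h$, and $$M=\psi(f,g,h)=\begin{pmatrix}e^{\frac12 Pg}C_{F,H}&e^{\frac12 Pg}S_{H,F}\\ e^{-\frac12 Pg}S_{F,H}&e^{-\frac12 Pg}C_{H,F}\end{pmatrix}.$$ Then each entry of $M$ is locally absolutely continuous on $\mathbb{R}$, and $\det M\equiv 1$. Moreover, $$M'=\mathfrak{m}M\quad\text{(almost everywhere)}\quad\text{and}\quad M(0)=I,\qquad\text{where}\quad \mathfrak{m}=\begin{pmatrix}\frac12 g&h\\ -f&-\frac12 g\end{pmatrix}$$ and $I$ is the $2\times 2$ identity matrix.
   Context: $L^1_{\mathrm{loc}}(\mathbb{R})$ denotes the space of locally integrable complex valued functions on $\mathbb{R}$, and $AC_{\mathrm{loc}}(\mathbb{R})$ the space of locally absolutely continuous complex valued functions on $\mathbb{R}$. For $u\in L^1_{\mathrm{loc}}(\mathbb{R})$, $Pu(x)=\int_0^x u$. For $u,v\in L^1_{\mathrm{loc}}(\mathbb{R})$ and $j\ge 1$ let $T^{(j)}_{u,v}(s_1,\ldots,s_j)=u(s_1)v(s_2)u(s_3)\cdots$ ($j$ factors, alternating $u$ with $v$, beginning with $u$). Set $A_0(u,v,x)=1$ and, for $j\geq 1$, $$A_j(u,v,x)=\int_{0<s_1<\cdots<s_j<x}T^{(j)}_{u,v}(s_1,\ldots,s_j)\,ds_1\cdots ds_j\quad (x\ge 0),$$ $$A_j(u,v,x)=(-1)^j\int_{x<s_j<\cdots<s_1<0}T^{(j)}_{u,v}(s_1,\ldots,s_j)\,ds_1\cdots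 ds_j\quad (x\le 0).$$ The bivariate exponential is $E_{u,v}(x)=1+\sum_{j=1}^\infty A_j(u,v,x)$ for $x\in\mathbb{R}$, and $$C_{u,v}=\tfrac12\bigl(E_{u,v}+E_{-u,-v}\bigr),\qquad S_{u,v}=\tfrac12\bigl(E_{u,v}-E_{-u,-v}\bigr).$$ *)

theory Defs
  imports "HOL-Analysis.Analysis"
begin

text \<open>
  Elements of \<open>L\<^sup>1\<^sub>l\<^sub>o\<^sub>c(\<real>)\<close> are represented by arbitrary Lebesgue measurable representatives, so all
  integrals below are taken with respect to \<^const>\<open>lebesgue\<close> rather than \<^const>\<open>lborel\<close>.
\<close>

definition locally_integrable :: "(real \<Rightarrow> complex) \<Rightarrow> bool" where
  "locally_integrable u \<longleftrightarrow> (\<forall>a b. u absolutely_integrable_on {a..b})"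

definition abs_continuous_on_interval :: "real \<Rightarrow> real \<Rightarrow> (real \<Rightarrow> complex) \<Rightarrow> bool" where
  "abs_continuous_on_interval a b \<phi> \<longleftrightarrow>
     (\<forall>\<epsilon>>0. \<exists>\<delta>>0. \<forall>(n::nat) (l::nat \<Rightarrow> real) (r::nat \<Rightarrow> real).
        (\<forall>i<n. a \<le> l i \<and> l i \<le> r i \<and> r i \<le> b) \<and>
        disjoint_family_on (\<lambda>i. {l i<..<r i}) {..<n} \<and>
        (\<Sum>i<n. r i - l i) < \<delta>
        \<longrightarrow> (\<Sum>i<n. norm (\<phi> (r i) - \<phi> (l i))) < \<epsilon>)"

definition locally_abs_continuous :: "(real \<Rightarrow> complex) \<Rightarrow> bool" where
  "locally_abs_continuous \<phi> \<longleftrightarrow> (\<forall>a b. abs_continuous_on_interval a b \<phi>)"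

text \<open>The integral below is oriented: for \<open>x < 0\<close> it is minus the integral of \<open>u\<close> over \<open>(x, 0)\<close>.\<close>

definition prim :: "(real \<Rightarrow> complex) \<Rightarrow> real \<Rightarrow> complex" where
  "prim u x = interval_lebesgue_integral lebesgue (ereal 0) (ereal x) u"

definition alt_prod ::
    "nat \<Rightarrow> (real \<Rightarrow> complex) \<Rightarrow> (real \<Rightarrow> complex) \<Rightarrow> (nat \<Rightarrow> real) \<Rightarrow> complex" where
  "alt_prod j u v s = (\<Prod>i\<in>{1..j}. if odd i then u (s i) else v (s i))"

text \<open>
  Points \<open>(s\<^sub>1, \<dots>, s\<^sub>j)\<close> are functions on the index set \<open>{1..j}\<close>, and \<open>ds\<^sub>1 \<cdots> ds\<^sub>j\<close> is the product of
  \<open>j\<close> copies of \<^const>\<open>lebesgue\<close>.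
\<close>

definition simplex_int :: "nat \<Rightarrow> (real \<Rightarrow> complex) \<Rightarrow> (real \<Rightarrow> complex) \<Rightarrow> real \<Rightarrow> complex" where
  "simplex_int j u v x =
     (if j = 0 then 1
      else if 0 \<le> x then
        (LINT s:{s. 0 < s 1 \<and> (\<forall>i\<in>{1..<j}. s i < s (Suc i)) \<and> s j < x}
           |PiM {1..j} (\<lambda>_. lebesgue). alt_prod j u v s)
      else
        (-1) ^ j *
        (LINT s:{s. x < s j \<and> (\<forall>i\<in>{1..<j}. s (Suc i) < s i) \<and> s 1 < 0}
           |PiM {1..j} (\<lambda>_. lebesgue). alt_prod j u v s))"

definition biv_exp :: "(real \<Rightarrow> complex) \<Rightarrow> (real \<Rightarrow> complex) \<Rightarrow> real \<Rightarrow> complex" where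
  "biv_exp u v x = 1 + (\<Sum>j. simplex_int (Suc j) u v x)"

definition biv_cosh :: "(real \<Rightarrow> complex) \<Rightarrow> (real \<Rightarrow> complex) \<Rightarrow> real \<Rightarrow> complex" where
  "biv_cosh u v x = (biv_exp u v x + biv_exp (\<lambda>t. - u t) (\<lambda>t. - v t) x) / 2"

definition biv_sinh :: "(real \<Rightarrow> complex) \<Rightarrow> (real \<Rightarrow> complex) \<Rightarrow> real \<Rightarrow> complex" where
  "biv_sinh u v x = (biv_exp u v x - biv_exp (\<lambda>t. - u t) (\<lambda>t. - v t) x) / 2"

definition psi ::
    "(real \<Rightarrow> complex) \<Rightarrow> (real \<Rightarrow> complex) \<Rightarrow> (real \<Rightarrow> complex) \<Rightarrow> real \<Rightarrow> complex^2^2" where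
  "psi f g h x =
     (let F = (\<lambda>t. - exp (prim g t) * f t);
          H = (\<lambda>t. exp (- prim g t) * h t)
      in vector [vector [exp (prim g x / 2) * biv_cosh F H x, exp (prim g x / 2) * biv_sinh H F x],
                 vector [exp (- prim g x / 2) * biv_sinh F H x, exp (- prim g x / 2) * biv_cosh H F x]])"

definition coeff_matrix ::
    "(real \<Rightarrow> complex) \<Rightarrow> (real \<Rightarrow> complex) \<Rightarrow> (real \<Rightarrow> complex) \<Rightarrow> real \<Rightarrow> complex^2^2" where
  "coeff_matrix f g h x = vector [vector [g x / 2, h x], vector [- f x, - g x / 2]]"

end

theory Submission
  imports Defs
begin

text \<open>
  Fubini's theorem on the ordered simplex gives \<open>A\<^sub>j\<^sub>+\<^sub>1 = P(w A\<^sub>j)\<close> with \<open>w = u\<close> for even \<open>j\<close> and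
  \<open>w = v\<close> for odd \<open>j\<close>. Since \<open>\<bar>A\<^sub>j\<bar> \<le> \<bar>P(\<bar>u\<bar> + \<bar>v\<bar>)\<bar>\<^sup>j / j!\<close>, summing over even and odd \<open>j\<close> yields
  \<open>C = 1 + P(v S)\<close> and \<open>S = P(u C)\<close>. Local absolute continuity and the differential equation then
  follow from Lebesgue's differentiation theorem. The determinant is
  \<open>C\<^sub>F\<^sub>,\<^sub>H C\<^sub>H\<^sub>,\<^sub>F - S\<^sub>F\<^sub>,\<^sub>H S\<^sub>H\<^sub>,\<^sub>F\<close>, and integration by parts turns both products into primitives of the
  same function, so that it is constant.
\<close>

subsection \<open>Primitives of locally integrable functions\<close>

text \<open>The functions \<open>F\<close> and \<open>H\<close> come from a gauge transformation.
  Writing \<open>M = diag(exp (Pg/2), exp (-Pg/2)) X\<close> removes the diagonal of the coefficient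
  matrix and leaves \<open>X' = [[0, H], [F, 0]] X\<close>, which column by column is the system
  \<open>C' = v S\<close>, \<open>S' = u C\<close> (with \<open>u\<close> and \<open>v\<close>
  interchanged for the second column). Iterating it from the value at 0 produces the integrals
  \<open>A_j\<close>. The coefficients are merely measurable, so derivatives exist only almost
  everywhere, and a derivative that vanishes almost everywhere does not make a function constant.
  The argument therefore works with identities between primitives, which hold at every point, and
  differentiates only at the very end. The product rule accordingly appears as integration by parts,
  proved by Fubini; the same rule, applied to powers of a primitive, is the source of the factorial
  in the bound for \<open>A_j\<close>. One circularity has to be broken: the recursion for
  \<open>A_j\<close> needs \<open>A_j\<close> to be measurable, which comes from its continuity,
  which in turn comes from the recursion. A single induction on \<open>j\<close> settles
  both.\<close>

text \<open>The sign \<open>\<sigma>\<close> treats the half-lines \<open>x \<ge> 0\<close> and \<open>x \<le> 0\<close> simultaneously.\<close>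

definition signed_interval :: "real \<Rightarrow> real \<Rightarrow> real set" where
  "signed_interval \<sigma> x = {t. 0 < \<sigma> * t \<and> \<sigma> * t < \<sigma> * x}"

lemma signed_interval_measurable [measurable]: "signed_interval \<sigma> x \<in> sets borel"
  unfolding signed_interval_def by measurable

lemma signed_interval_subset: "signed_interval \<sigma> x \<subseteq> {-\<bar>x\<bar>..\<bar>x\<bar>}" if "\<bar>\<sigma>\<bar> = 1"
  using that by (auto simp: signed_interval_def abs_if split: if_splits)

lemma locally_integrable_measurable:
  assumes "locally_integrable u"
  shows "u \<in> borel_measurable lebesgue"
proof (rule borel_measurable_LIMSEQ_metric)
  show "(\<lambda>x. indicat_real {-real n..real n} x *\<^sub>R u x) \<in> borel_measurable lebesgue" for n
    using assms borel_measurable_integrable unfolding locally_integrable_def set_integrable_def by blast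
  fix x
  obtain N where N: "\<bar>x\<bar> \<le> real N" using real_arch_simple by blast
  have "\<forall>\<^sub>F n in sequentially. indicat_real {-real n..real n} x *\<^sub>R u x = u x"
    using eventually_ge_at_top[of N] by eventually_elim (use N in \<open>auto simp: indicator_def\<close>)
  then show "(\<lambda>n. indicat_real {-real n..real n} x *\<^sub>R u x) \<longlonglongrightarrow> u x"
    by (rule tendsto_eventually)
qed

lemma locally_integrableI:
  assumes "u \<in> borel_measurable lebesgue" "\<And>a b. (\<lambda>x. norm (u x)) integrable_on {a..b}"
  shows "locally_integrable u"
  unfolding locally_integrable_def
proof (intro allI)
  fix a b :: real
  show "u absolutely_integrable_on {a..b}"
    by (rule measurable_bounded_by_integrable_imp_absolutely_integrable[OF _ _ assms(2)])
       (auto intro: measurable_restrict_space1 assms)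
qed

lemma locally_integrable_on_interval:
  "locally_integrable u \<Longrightarrow> u integrable_on {a..b}"
  "locally_integrable u \<Longrightarrow> (\<lambda>x. norm (u x)) integrable_on {a..b}"
  by (auto simp: locally_integrable_def absolutely_integrable_on_def)

lemma locally_integrable_subset:
  assumes "locally_integrable u" "S \<in> sets lebesgue" "S \<subseteq> {a..b}"
  shows "u absolutely_integrable_on S"
  using assms set_integrable_subset unfolding locally_integrable_def by blast

lemma locally_integrable_norm:
  "locally_integrable u \<Longrightarrow> locally_integrable (\<lambda>x. of_real (norm (u x)))"
  using locally_integrable_measurable[of u] locally_integrable_on_interval(2)[of u]
  by (intro locally_integrableI) simp_all

lemma locally_integrable_add:
  "locally_integrable u \<Longrightarrow> locally_integrable v \<Longrightarrow> locally_integrable (\<lambda>x. u x + v x)"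
  by (auto simp: locally_integrable_def intro: set_integral_add)

lemma locally_integrable_minus:
  "locally_integrable u \<Longrightarrow> locally_integrable (\<lambda>x. - u x)"
  by (auto simp: locally_integrable_def set_integrable_def)

lemma locally_integrable_mult_continuous:
  assumes u: "locally_integrable u" and c: "continuous_on UNIV c"
  shows "locally_integrable (\<lambda>x. c x * u x)"
  unfolding locally_integrable_def
proof (intro allI, rule absolutely_integrable_bounded_measurable_product[where h="(*)"])
  fix a b :: real
  show "bilinear ((*) :: complex \<Rightarrow> _)" by (rule bilinear_times)
  have c': "continuous_on {a..b} c" using c continuous_on_subset by blast
  show "c \<in> borel_measurable (lebesgue_on {a..b})"
    by (rule continuous_imp_measurable_on_sets_lebesgue[OF c']) auto
  show "bounded (c ` {a..b})"
    using compact_continuous_image[OF c'] compact_imp_bounded by blast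
qed (use u in \<open>auto simp: locally_integrable_def\<close>)

text \<open>The orientation of the integral becomes the factor \<open>\<sigma>\<close>, so that
  Fubini arguments can be carried out once for both half-lines. At \<open>x = 0\<close> both signs
  are admissible.\<close>

lemma prim_eq_signed:
  assumes "\<bar>\<sigma>\<bar> = 1" "0 \<le> \<sigma> * x"
  shows "prim u x = of_real \<sigma> * (\<integral>t. indicat_real (signed_interval \<sigma> x) t *\<^sub>R u t \<partial>lebesgue)"
proof -
  consider "\<sigma> = 1" "0 \<le> x" | "\<sigma> = -1" "x \<le> 0" using assms by (auto simp: abs_if split: if_splits)
  then show ?thesis
  proof cases
    case 1
    have "einterval 0 (ereal x) = signed_interval \<sigma> x"
      using 1 by (auto simp: einterval_def signed_interval_def)
    moreover have "0 \<le> ereal x" using 1 by simp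
    ultimately show ?thesis using 1(1) unfolding prim_def interval_lebesgue_integral_def
          set_lebesgue_integral_def zero_ereal_def[symmetric] by simp
  next
    case 2
    have e: "einterval (ereal x) 0 = signed_interval \<sigma> x" "einterval 0 0 = {}"
      using 2 by (auto simp: einterval_def signed_interval_def)
    \<comment> \<open>For \<open>\<sigma> = -1\<close> and \<open>x = 0\<close> the interval
      integral takes its increasing branch, without a minus sign; this is harmless because the
      interval is empty.\<close>
    show ?thesis
    proof (cases "x = 0")
      case True
      have "signed_interval \<sigma> 0 = {}" by (auto simp: signed_interval_def)
      then show ?thesis using True e(2)
        by (simp add: prim_def interval_lebesgue_integral_def set_lebesgue_integral_def)
    next
      case False
      then have "ereal x < 0" "\<not> (0 \<le> ereal x)" using 2 by auto
      then show ?thesis using e(1) 2(1) unfolding prim_def interval_lebesgue_integral_def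
          set_lebesgue_integral_def zero_ereal_def[symmetric] by simp
    qed
  qed
qed

lemma signed_cases:
  fixes x :: real
  obtains \<sigma> :: real where "\<bar>\<sigma>\<bar> = 1" "0 \<le> \<sigma> * x"
proof (cases "0 \<le> x")
  case True then show ?thesis using that[of 1] by simp
next
  case False then show ?thesis using that[of "-1"] by simp
qed

lemma prim_integral:
  assumes "locally_integrable u"
  shows "prim u x = (if 0 \<le> x then integral {0..x} u else - integral {x..0} u)"
proof -
  have *: "(\<integral>t. indicat_real (signed_interval \<sigma> x) t *\<^sub>R u t \<partial>lebesgue) = integral (signed_interval \<sigma> x) u"
    if "\<bar>\<sigma>\<bar> = 1" for \<sigma>
  proof -
    have "u absolutely_integrable_on signed_interval \<sigma> x"
      by (rule locally_integrable_subset[OF assms _ signed_interval_subset[OF that]]) simp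
    then show ?thesis
      using set_lebesgue_integral_eq_integral(2) unfolding set_lebesgue_integral_def by blast
  qed
  have eq: "prim u x = of_real \<sigma> * integral (signed_interval \<sigma> x) u" if "\<bar>\<sigma>\<bar> = 1" "0 \<le> \<sigma> * x" for \<sigma>
    using prim_eq_signed[OF that] *[OF that(1)] by metis
  show ?thesis
  proof (cases "0 \<le> x")
    case True
    have "signed_interval 1 x = {0<..<x}" by (auto simp: signed_interval_def)
    then have "prim u x = integral {0<..<x} u" using eq[of 1] True by simp
    then show ?thesis using True integral_open_interval_real[of 0 x u] by metis
  next
    case False
    have "signed_interval (-1) x = {x<..<0}" by (auto simp: signed_interval_def)
    then have "prim u x = - integral {x<..<0} u" using eq[of "-1"] False by simp
    then show ?thesis using False integral_open_interval_real[of x 0 u] by metis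
  qed
qed

lemma prim_0 [simp]: "prim u 0 = 0"
  using prim_eq_signed[of 1 0 u] by (simp add: signed_interval_def)

lemma prim_diff:
  assumes "locally_integrable u" "a \<le> b"
  shows "prim u b - prim u a = integral {a..b} u"
proof -
  have *: "integral {a..b} u + integral {b..c} u = integral {a..c} u" if "a \<le> b" "b \<le> c" for a b c
    by (intro Henstock_Kurzweil_Integration.integral_combine that locally_integrable_on_interval(1) assms(1))
  consider "0 \<le> a" | "a < 0" "0 \<le> b" | "b < 0" using assms(2) by linarith
  then show ?thesis
  proof cases
    case 1 then show ?thesis using *[of 0 a b, symmetric] assms(2) by (simp add: prim_integral[OF assms(1)])
  next
    case 2 then show ?thesis using *[of a 0 b, symmetric] by (simp add: prim_integral[OF assms(1)])
  next
    case 3 then show ?thesis using *[of a b 0, symmetric] assms(2) by (simp add: prim_integral[OF assms(1)])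
  qed
qed

lemma prim_add:
  assumes "locally_integrable u" "locally_integrable v"
  shows "prim (\<lambda>t. u t + v t) x = prim u x + prim v x"
  using assms
  by (simp add: prim_integral locally_integrable_add locally_integrable_on_interval
      Henstock_Kurzweil_Integration.integral_add)

lemma prim_cmult: "prim (\<lambda>t. c * u t) x = c * prim u x"
  unfolding prim_def by simp

lemma continuous_prim:
  assumes "locally_integrable u"
  shows "continuous_on UNIV (prim u)"
proof -
  have "isCont (prim u) x" for x
  proof -
    have "continuous_on {x-1..x+1} (\<lambda>y. prim u (x-1) + integral {x-1..y} u)"
      by (intro continuous_intros indefinite_integral_continuous_1 locally_integrable_on_interval assms)
    then have "continuous_on {x-1..x+1} (prim u)"
    proof (rule continuous_on_eq)
      fix y assume "y \<in> {x-1..x+1}"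
      then show "prim u (x-1) + integral {x-1..y} u = prim u y"
        by (simp flip: prim_diff[OF assms])
    qed
    then show ?thesis
      using continuous_on_interior[of "{x-1..x+1}" "prim u" x] by simp
  qed
  then show ?thesis by (simp add: continuous_at_imp_continuous_on)
qed

text \<open>The majorant \<open>v\<close> is complex valued and may carry a constant phase, which
  \<open>c\<close> cancels: the integral of \<open>Re (c * v t)\<close> is
  \<open>Re (c * integral v)\<close>, and this is at most the norm of the integral of
  \<open>v\<close>. In the application \<open>v\<close> contains a power of a primitive, whose sign
  is \<open>\<sigma>^j\<close>.\<close>

lemma norm_prim_le:
  assumes u: "locally_integrable u" and v: "locally_integrable v" and c: "norm c = 1"
    and le: "\<And>t. t \<in> closed_segment 0 x \<Longrightarrow> norm (u t) \<le> Re (c * v t)"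
  shows "norm (prim u x) \<le> norm (prim v x)"
proof -
  have n: "norm (integral {a..b} u) \<le> norm (integral {a..b} v)" if "{a..b} = closed_segment 0 x" for a b
  proof -
    have lin: "bounded_linear (\<lambda>z. Re (c * z))"
      using bounded_linear_compose[OF bounded_linear_Re bounded_linear_mult_right[of c]] .
    have "norm (integral {a..b} u) \<le> integral {a..b} (\<lambda>t. Re (c * v t))"
    proof (rule integral_norm_bound_integral)
      show "(\<lambda>t. Re (c * v t)) integrable_on {a..b}"
        using integrable_linear[OF locally_integrable_on_interval(1)[OF v] lin] by (simp only: o_def)
      show "norm (u t) \<le> Re (c * v t)" if "t \<in> {a..b}" for t
        using le that \<open>{a..b} = closed_segment 0 x\<close> by blast
    qed (rule locally_integrable_on_interval(1)[OF u])
    also have "\<dots> = Re (c * integral {a..b} v)"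
      using integral_linear[OF locally_integrable_on_interval(1)[OF v] lin] by (simp add: o_def)
    also have "\<dots> \<le> norm (integral {a..b} v)"
      using complex_Re_le_cmod[of "c * integral {a..b} v"] by (simp add: norm_mult c)
    finally show ?thesis .
  qed
  show ?thesis using n by (auto simp: prim_integral u v closed_segment_eq_real_ivl)
qed

section \<open>Lebesgue differentiation of primitives\<close>

lemma AE_prim_right_derivative:
  assumes "locally_integrable u"
  shows "AE x in lebesgue. (prim u has_vector_derivative u x) (at_right x)"
proof -
  \<comment> \<open>This form of Lebesgue's theorem concerns averages over \<open>[x, x + h]\<close>
    with \<open>h > 0\<close> only, hence it controls just the right derivative.\<close>
  obtain N where N: "negligible N" and d: "\<And>x e. \<lbrakk>x \<notin> N; 0 < e\<rbrakk> \<Longrightarrow>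
     \<exists>d>0. \<forall>h. 0 < h \<and> h < d \<longrightarrow> norm(integral (cbox x (x + h *\<^sub>R One)) u /\<^sub>R h ^ DIM(real) - u x) < e"
    using integrable_ccontinuous_explicit[of u] locally_integrable_on_interval[OF assms] by (metis box_real(2))
  have "(prim u has_vector_derivative u x) (at_right x)" if x: "x \<notin> N" for x
    unfolding has_vector_derivative_def has_derivative_within'
  proof (intro conjI allI impI)
    fix e :: real assume "e > 0"
    then obtain d' where d': "d' > 0"
      "\<And>h. 0 < h \<Longrightarrow> h < d' \<Longrightarrow> norm (integral {x..x+h} u /\<^sub>R h - u x) < e"
      using d[OF x \<open>e > 0\<close>] by (simp add: cbox_interval) blast
    show "\<exists>d>0. \<forall>x'\<in>{x<..}. 0 < norm (x' - x) \<and> norm (x' - x) < d \<longrightarrow>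
      norm (prim u x' - prim u x - (x' - x) *\<^sub>R u x) / norm (x' - x) < e"
    proof (intro exI[of _ d'] conjI d' ballI impI)
      fix x' assume x': "x' \<in> {x<..}" "0 < norm (x' - x) \<and> norm (x' - x) < d'"
      define h where "h = x' - x"
      have h: "0 < h" "h < d'" "x' = x + h" using x' by (auto simp: h_def)
      have "norm (prim u x' - prim u x - (x' - x) *\<^sub>R u x) = norm (h *\<^sub>R (integral {x..x+h} u /\<^sub>R h - u x))"
        using h by (simp add: prim_diff[OF assms] scaleR_diff_right)
      also have "\<dots> = h * norm (integral {x..x+h} u /\<^sub>R h - u x)" using h by simp
      also have "\<dots> < h * e" using d'(2)[of h] h by simp
      finally show "norm (prim u x' - prim u x - (x' - x) *\<^sub>R u x) / norm (x' - x) < e"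
        using h by (simp add: field_simps)
    qed
  qed (auto intro: bounded_linear_intros)
  then show ?thesis
    using N unfolding negligible_iff_null_sets
    by (intro AE_I'[of N]) auto
qed

lemma locally_integrable_reflect:
  assumes "locally_integrable u" shows "locally_integrable (\<lambda>x. u (- x))"
  unfolding locally_integrable_def absolutely_integrable_on_def
proof (intro allI conjI)
  fix a b :: real
  show "(\<lambda>x. u (- x)) integrable_on {a..b}"
    using Henstock_Kurzweil_Integration.integrable_reflect_real[of u "-a" "-b"]
      locally_integrable_on_interval(1)[OF assms, of "-b" "-a"] by simp
  show "(\<lambda>x. norm (u (- x))) integrable_on {a..b}"
    using Henstock_Kurzweil_Integration.integrable_reflect_real[of "\<lambda>x. norm (u x)" "-a" "-b"]
      locally_integrable_on_interval(2)[OF assms, of "-b" "-a"] by simp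
qed

lemma prim_reflect:
  assumes "locally_integrable u"
  shows "prim (\<lambda>x. u (- x)) x = - prim u (- x)"
  using Henstock_Kurzweil_Integration.integral_reflect_real[of 0 "-x" u] Henstock_Kurzweil_Integration.integral_reflect_real[of "-x" 0 u]
  by (simp add: prim_integral assms locally_integrable_reflect)

text \<open>The left derivative of the primitive of \<open>u\<close> at \<open>x\<close> is the
  right derivative at \<open>-x\<close> of the primitive of the reflected function, since reflection
  turns \<open>prim u\<close> into \<open>- prim u (- x)\<close>. The exceptional set becomes its
  mirror image, which is null as the image of a null set under a differentiable map.\<close>

lemma AE_prim_derivative:
  assumes "locally_integrable u"
  shows "AE x in lebesgue. (prim u has_vector_derivative u x) (at x)"
proof -
  let ?v = "\<lambda>x. u (- x)"
  obtain N where N: "N \<in> null_sets lebesgue"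
    and v: "\<And>x. x \<notin> N \<Longrightarrow> (prim ?v has_vector_derivative ?v x) (at_right x)"
    using AE_prim_right_derivative[OF locally_integrable_reflect[OF assms]]
    by (auto elim!: AE_E3)
  have "(prim u has_vector_derivative u x) (at_left x)" if "x \<notin> uminus ` N" for x
  proof -
    have "- x \<notin> N" using that by (metis image_eqI minus_minus)
    from v[OF this] have v': "(prim ?v has_vector_derivative u x) (at (- x) within {-x<..})" by simp
    have eq: "uminus ` {..<x} = {-x<..}" by simp
    have "((\<lambda>y. - prim ?v (- y)) has_vector_derivative u x) (at x within {..<x})"
      using vector_diff_chain_within[of uminus "-1" x "{..<x}" "prim ?v" "u x"] v'
      by (force intro!: derivative_eq_intros simp: o_def eq)
    then show ?thesis by (simp add: prim_reflect[OF assms])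
  qed
  moreover have "uminus ` N \<in> null_sets lebesgue"
    using N by (auto simp flip: negligible_iff_null_sets
        intro!: negligible_differentiable_image_negligible derivative_intros)
  ultimately have "AE x in lebesgue. (prim u has_vector_derivative u x) (at_left x)"
    by (intro AE_I'[of "uminus ` N"]) auto
  with AE_prim_right_derivative[OF assms] show ?thesis
  proof eventually_elim
    case (elim x)
    then show ?case
      unfolding has_vector_derivative_def has_derivative_within filterlim_at_split by blast
  qed
qed

section \<open>Absolute continuity of primitives\<close>

lemma prim_diff_le:
  assumes "locally_integrable u" "l \<le> r"
  shows "norm (prim u r - prim u l) \<le> (\<integral>t. indicat_real {l<..<r} t * norm (u t) \<partial>lebesgue)"
proof -
  have i: "u absolutely_integrable_on {l<..<r}"
    by (rule locally_integrable_subset[OF assms(1), of _ l r]) auto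
  have "prim u r - prim u l = (LINT t:{l<..<r}|lebesgue. u t)"
    using set_lebesgue_integral_eq_integral(2)[OF i] integral_open_interval_real[of l r u]
    by (simp add: prim_diff assms)
  also have "norm \<dots> \<le> (\<integral>t. norm (indicat_real {l<..<r} t *\<^sub>R u t) \<partial>lebesgue)"
    unfolding set_lebesgue_integral_def by (rule integral_norm_bound)
  finally show ?thesis by simp
qed

lemma integrable_indicator_norm:
  assumes "locally_integrable u" "S \<in> sets lebesgue" "S \<subseteq> {a..b}"
  shows "integrable lebesgue (\<lambda>t. indicat_real S t * norm (u t))"
proof -
  have "integrable lebesgue (\<lambda>t. norm (indicat_real S t *\<^sub>R u t))"
    using locally_integrable_subset[OF assms] unfolding set_integrable_def by (rule integrable_norm)
  then show ?thesis by simp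
qed

lemma id_measurable_lebesgue [measurable]: "(\<lambda>x::real. x) \<in> borel_measurable lebesgue"
  by (rule measurable_completion) simp

text \<open>Truncating \<open>norm u\<close> at height \<open>k\<close> leaves a tail with small integral, and the bounded part
  contributes at most \<open>k\<close> times the total length.\<close>

lemma locally_abs_continuous_prim:
  assumes u: "locally_integrable u"
  shows "locally_abs_continuous (prim u)"
  unfolding locally_abs_continuous_def abs_continuous_on_interval_def
proof (intro allI impI)
  fix a b \<epsilon> :: real assume "\<epsilon> > 0"
  let ?I = "\<lambda>t. indicat_real {a..b} t"
  note [measurable] = locally_integrable_measurable[OF u]
  have int: "integrable lebesgue (\<lambda>t. ?I t * norm (u t))"
    by (rule integrable_indicator_norm[OF u]) auto
  have [measurable]: "(\<lambda>t. max 0 (norm (u t) - real k)) \<in> borel_measurable lebesgue" for k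
    by (intro borel_measurable_max) simp_all
  have "(\<lambda>k. \<integral>t. ?I t * max 0 (norm (u t) - real k) \<partial>lebesgue) \<longlonglongrightarrow> (\<integral>t. 0 \<partial>(lebesgue :: real measure))"
  proof (rule integral_dominated_convergence[OF _ _ int])
    show "AE t in lebesgue. (\<lambda>k. ?I t * max 0 (norm (u t) - real k)) \<longlonglongrightarrow> 0"
    proof (intro AE_I2 tendsto_eventually)
      fix t
      obtain N where "norm (u t) \<le> real N" using real_arch_simple by blast
      then have "?I t * max 0 (norm (u t) - real k) = 0" if "N \<le> k" for k
        using that by (simp add: max_def)
      then show "\<forall>\<^sub>F k in sequentially. ?I t * max 0 (norm (u t) - real k) = 0"
        unfolding eventually_sequentially by blast
    qed
    show "AE t in lebesgue. norm (?I t * max 0 (norm (u t) - real k)) \<le> ?I t * norm (u t)" for k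
      by (intro AE_I2) (auto simp: indicator_def)
  qed measurable
  then have "\<forall>\<^sub>F k in sequentially. (\<integral>t. ?I t * max 0 (norm (u t) - real k) \<partial>lebesgue) < \<epsilon> / 2"
    using \<open>\<epsilon> > 0\<close> by (intro order_tendstoD(2)) auto
  then obtain k where k: "(\<integral>t. ?I t * max 0 (norm (u t) - real k) \<partial>lebesgue) < \<epsilon> / 2"
    by (meson eventually_happens trivial_limit_sequentially)
  have int': "integrable lebesgue (\<lambda>t. ?I t * max 0 (norm (u t) - real k))"
    by (rule Bochner_Integration.integrable_bound[OF int]) (auto simp: indicator_def)
  show "\<exists>\<delta>>0. \<forall>(n::nat) (l::nat \<Rightarrow> real) r. (\<forall>i<n. a \<le> l i \<and> l i \<le> r i \<and> r i \<le> b) \<and>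
      disjoint_family_on (\<lambda>i. {l i<..<r i}) {..<n} \<and> (\<Sum>i<n. r i - l i) < \<delta> \<longrightarrow>
      (\<Sum>i<n. norm (prim u (r i) - prim u (l i))) < \<epsilon>"
  \<comment> \<open>Half of \<open>\<epsilon>\<close> is reserved for the tail above height
    \<open>k\<close>. The bounded part costs at most \<open>k\<close> times the total length;
    \<open>k + 1\<close> keeps the denominator positive when \<open>k = 0\<close>.\<close>
  proof (intro exI[of _ "\<epsilon> / (2 * (real k + 1))"] conjI allI impI)
    show "0 < \<epsilon> / (2 * (real k + 1))" using \<open>\<epsilon> > 0\<close> by simp
    fix n :: nat and l r :: "nat \<Rightarrow> real"
    assume H: "(\<forall>i<n. a \<le> l i \<and> l i \<le> r i \<and> r i \<le> b) \<and>
      disjoint_family_on (\<lambda>i. {l i<..<r i}) {..<n} \<and> (\<Sum>i<n. r i - l i) < \<epsilon> / (2 * (real k + 1))"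
    let ?J = "\<lambda>i t. indicat_real {l i<..<r i} t"
    let ?w = "\<lambda>t. max 0 (norm (u t) - real k)"
    have intJ: "integrable lebesgue (\<lambda>t. ?J i t * norm (u t))" for i
      by (rule integrable_indicator_norm[OF u, of _ "l i" "r i"]) auto
    have intw: "integrable lebesgue (\<lambda>t. ?J i t * ?w t)" for i
      by (rule Bochner_Integration.integrable_bound[OF intJ[of i]]) (auto simp: indicator_def)
    have intl: "integrable lebesgue (\<lambda>t. ?J i t)" for i
      using lmeasurable_box[of "l i" "r i"] by (auto simp: fmeasurable_def intro!: integrable_real_indicator)
    have "(\<Sum>i<n. norm (prim u (r i) - prim u (l i))) \<le> (\<Sum>i<n. (\<integral>t. ?J i t * ?w t \<partial>lebesgue) + real k * (r i - l i))"
    proof (rule sum_mono)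
      fix i assume "i \<in> {..<n}"
      then have lr: "l i \<le> r i" using H by auto
      have "norm (prim u (r i) - prim u (l i)) \<le> (\<integral>t. ?J i t * norm (u t) \<partial>lebesgue)"
        by (rule prim_diff_le[OF u lr])
      also have "\<dots> \<le> (\<integral>t. ?J i t * ?w t + real k * ?J i t \<partial>lebesgue)"
        using intJ intw intl by (intro integral_mono) (auto simp: indicator_def)
      also have "\<dots> = (\<integral>t. ?J i t * ?w t \<partial>lebesgue) + real k * (r i - l i)"
        using intw intl lr by simp
      finally show "norm (prim u (r i) - prim u (l i)) \<le> (\<integral>t. ?J i t * ?w t \<partial>lebesgue) + real k * (r i - l i)" .
    qed
    also have "\<dots> = (\<integral>t. (\<Sum>i<n. ?J i t * ?w t) \<partial>lebesgue) + real k * (\<Sum>i<n. r i - l i)"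
      by (simp only: sum.distrib sum_distrib_left Bochner_Integration.integral_sum[OF intw])
    finally have 1: "(\<Sum>i<n. norm (prim u (r i) - prim u (l i))) \<le>
        (\<integral>t. (\<Sum>i<n. ?J i t * ?w t) \<partial>lebesgue) + real k * (\<Sum>i<n. r i - l i)" .
    have 2: "(\<integral>t. (\<Sum>i<n. ?J i t * ?w t) \<partial>lebesgue) \<le> (\<integral>t. ?I t * ?w t \<partial>lebesgue)"
    proof (rule integral_mono)
      fix t
      \<comment> \<open>Disjointness is what allows all tails together to be charged to the one
        integral over \<open>{a..b}\<close> that \<open>k\<close> made small.\<close>
      have "(\<Sum>i<n. ?J i t) = indicat_real (\<Union>i<n. {l i<..<r i}) t"
        using H by (subst indicator_UN_disjoint) auto
      also have "\<dots> \<le> ?I t" using H by (force simp: indicator_def)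
      finally show "(\<Sum>i<n. ?J i t * ?w t) \<le> ?I t * ?w t"
        unfolding sum_distrib_right[symmetric] by (rule mult_right_mono) simp
    qed (rule Bochner_Integration.integrable_sum[OF intw] int')+
    have "real k * (\<Sum>i<n. r i - l i) \<le> (real k + 1) * (\<Sum>i<n. r i - l i)"
      using H by (intro mult_right_mono sum_nonneg) auto
    also have "\<dots> \<le> (real k + 1) * (\<epsilon> / (2 * (real k + 1)))"
      using H by (intro mult_left_mono) auto
    also have "\<dots> = \<epsilon> / 2" by (simp add: field_simps)
    finally show "(\<Sum>i<n. norm (prim u (r i) - prim u (l i))) < \<epsilon>" using 1 2 k by linarith
  qed
qed

section \<open>Integration by parts by means of Fubini's theorem\<close>

lemma sigma_finite_lebesgue: "sigma_finite_measure (lebesgue :: real measure)"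
proof
  have "\<Union> (range (\<lambda>n::nat. {-real n..real n})) = UNIV"
    using real_arch_simple[of "\<bar>x\<bar>" for x] by (force simp: abs_le_iff)
  then show "\<exists>A. countable A \<and> A \<subseteq> sets (lebesgue :: real measure) \<and> \<Union> A = space lebesgue \<and> (\<forall>a\<in>A. emeasure lebesgue a \<noteq> \<infinity>)"
    by (intro exI[of _ "range (\<lambda>n::nat. {-real n..real n})"]) auto
qed

lemma integrable_on_signed_interval:
  assumes "locally_integrable u" "\<bar>\<sigma>\<bar> = 1"
  shows "integrable lebesgue (\<lambda>t. indicat_real (signed_interval \<sigma> x) t *\<^sub>R u t)"
  using locally_integrable_subset[OF assms(1) _ signed_interval_subset[OF assms(2)], of x]
  by (simp add: set_integrable_def)

text \<open>The product of the two integrals is a double integral over a square. The diagonal cuts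
  the square into two triangles; integrating first over \<open>t\<close> in one and first over
  \<open>s\<close> in the other leaves the integrals of \<open>p * prim q\<close> and of
  \<open>prim p * q\<close>.\<close>

lemma prim_mult:
  assumes p: "locally_integrable p" and q: "locally_integrable q"
  shows "prim p x * prim q x = prim (\<lambda>t. p t * prim q t + prim p t * q t) x"
proof -
  obtain \<sigma> :: real where \<sigma>: "\<bar>\<sigma>\<bar> = 1" "0 \<le> \<sigma> * x" by (rule signed_cases)
  have \<sigma>2: "complex_of_real \<sigma> * complex_of_real \<sigma> = 1"
    using \<sigma>(1) by (metis abs_mult_self_eq mult_1 of_real_1 of_real_mult)
  let ?S = "signed_interval \<sigma> x"
  define p1 where "p1 = (\<lambda>t. indicat_real ?S t *\<^sub>R p t)"
  define q1 where "q1 = (\<lambda>t. indicat_real ?S t *\<^sub>R q t)"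
  have p1: "integrable lebesgue p1" and q1: "integrable lebesgue q1"
    unfolding p1_def q1_def using integrable_on_signed_interval p q \<sigma> by auto
  note [measurable] = borel_measurable_integrable[OF p1] borel_measurable_integrable[OF q1]
  interpret L: sigma_finite_measure "lebesgue :: real measure" by (rule sigma_finite_lebesgue)
  interpret pair_sigma_finite "lebesgue :: real measure" "lebesgue :: real measure" ..
  define f where "f = (\<lambda>s t. if \<sigma> * t < \<sigma> * s then p1 s * q1 t else 0)"
  define g where "g = (\<lambda>s t. if \<sigma> * t < \<sigma> * s then 0 else p1 s * q1 t)"
  have fg: "integrable (lebesgue \<Otimes>\<^sub>M lebesgue) (\<lambda>(s,t). p1 s * q1 t)"
  proof (rule Fubini_integrable)
    show "integrable lebesgue (\<lambda>s. \<integral>t. norm (case (s, t) of (s, t) \<Rightarrow> p1 s * q1 t) \<partial>lebesgue)"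
      using p1 by (simp add: norm_mult)
    show "AE s in lebesgue. integrable lebesgue (\<lambda>t. case (s, t) of (s, t) \<Rightarrow> p1 s * q1 t)"
      using q1 by simp
  qed measurable
  have f: "integrable (lebesgue \<Otimes>\<^sub>M lebesgue) (case_prod f)"
    by (rule Bochner_Integration.integrable_bound[OF fg]) (auto simp: f_def)
  have g: "integrable (lebesgue \<Otimes>\<^sub>M lebesgue) (case_prod g)"
    by (rule Bochner_Integration.integrable_bound[OF fg]) (auto simp: g_def)
  have Q: "(\<integral>t. f s t \<partial>lebesgue) = of_real \<sigma> * (indicat_real ?S s *\<^sub>R (p s * prim q s))" for s
  proof (cases "s \<in> ?S")
    case True
    then have s: "0 \<le> \<sigma> * s" by (simp add: signed_interval_def)
    have "f s t = p s * (indicat_real (signed_interval \<sigma> s) t *\<^sub>R q t)" for t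
      using True by (auto simp: f_def p1_def q1_def signed_interval_def indicator_def)
    then have "(\<integral>t. f s t \<partial>lebesgue) = p s * (\<integral>t. indicat_real (signed_interval \<sigma> s) t *\<^sub>R q t \<partial>lebesgue)"
      by (simp only: integral_mult_right_zero)
    also have "\<dots> = (complex_of_real \<sigma> * complex_of_real \<sigma>) * \<dots>" by (simp only: \<sigma>2 mult_1)
    finally show ?thesis using True prim_eq_signed[OF \<sigma>(1) s, of q] by (simp add: mult_ac)
  next
    case False
    then have "f s t = 0" for t by (simp add: f_def p1_def)
    then show ?thesis using False by simp
  qed
  have P: "(\<integral>s. g s t \<partial>lebesgue) = of_real \<sigma> * (indicat_real ?S t *\<^sub>R (prim p t * q t))" for t
  proof (cases "t \<in> ?S")
    case True
    then have t: "0 \<le> \<sigma> * t" by (simp add: signed_interval_def)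
    \<comment> \<open>The diagonal was assigned to \<open>g\<close>, so a section of
      \<open>g\<close> differs from one over the open \<open>signed_interval \<sigma> t\<close> at
      the single point \<open>t\<close>.\<close>
    have "AE s in lebesgue. s \<notin> {t}"
      by (intro AE_not_in) (auto simp: null_sets_def)
    then have "AE s in lebesgue. g s t = (indicat_real (signed_interval \<sigma> t) s *\<^sub>R p s) * q t"
    proof eventually_elim
      case (elim s)
      then have "\<sigma> * t \<noteq> \<sigma> * s" using \<sigma>(1) by auto
      then show ?case
        using True by (auto simp: g_def p1_def q1_def signed_interval_def indicator_def)
    qed
    then have "(\<integral>s. g s t \<partial>lebesgue) = (\<integral>s. (indicat_real (signed_interval \<sigma> t) s *\<^sub>R p s) * q t \<partial>lebesgue)"
      using locally_integrable_measurable[OF p] by (intro integral_cong_AE) (auto simp: g_def)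
    also have "\<dots> = (\<integral>s. indicat_real (signed_interval \<sigma> t) s *\<^sub>R p s \<partial>lebesgue) * q t"
      by (rule integral_mult_left_zero)
    also have "\<dots> = (complex_of_real \<sigma> * complex_of_real \<sigma>) * \<dots>" by (simp only: \<sigma>2 mult_1)
    finally show ?thesis using True prim_eq_signed[OF \<sigma>(1) t, of p] by (simp add: mult_ac)
  next
    case False
    then have "g s t = 0" for s by (simp add: g_def q1_def)
    then show ?thesis using False by simp
  qed
  let ?pQ = "\<lambda>t. p t * prim q t" and ?Pq = "\<lambda>t. prim p t * q t"
  have pQ: "locally_integrable ?pQ" "locally_integrable ?Pq"
    using locally_integrable_mult_continuous[OF p continuous_prim[OF q]]
      locally_integrable_mult_continuous[OF q continuous_prim[OF p]] by (simp_all add: mult.commute)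
  have "prim p x * prim q x = (\<integral>s. p1 s \<partial>lebesgue) * (\<integral>t. q1 t \<partial>lebesgue)"
    unfolding prim_eq_signed[OF \<sigma>] p1_def q1_def using \<sigma>2 by (simp add: algebra_simps)
  also have "\<dots> = (\<integral>s. (\<integral>t. p1 s * q1 t \<partial>lebesgue) \<partial>lebesgue)"
    by simp
  also have "\<dots> = (\<integral>z. (case z of (s, t) \<Rightarrow> p1 s * q1 t) \<partial>(lebesgue \<Otimes>\<^sub>M lebesgue))"
    using integral_fst'[OF fg] by simp
  also have "\<dots> = (\<integral>z. case_prod f z + case_prod g z \<partial>(lebesgue \<Otimes>\<^sub>M lebesgue))"
    by (intro Bochner_Integration.integral_cong) (auto simp: f_def g_def)
  also have "\<dots> = (\<integral>z. case_prod f z \<partial>(lebesgue \<Otimes>\<^sub>M lebesgue)) + (\<integral>z. case_prod g z \<partial>(lebesgue \<Otimes>\<^sub>M lebesgue))"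
    by (rule Bochner_Integration.integral_add[OF f g])
  also have "\<dots> = (\<integral>s. (\<integral>t. f s t \<partial>lebesgue) \<partial>lebesgue) + (\<integral>t. (\<integral>s. g s t \<partial>lebesgue) \<partial>lebesgue)"
    using integral_fst'[OF f] integral_snd[OF g] by simp
  also have "\<dots> = prim ?pQ x + prim ?Pq x"
    unfolding P Q prim_eq_signed[OF \<sigma>] by (simp only: integral_mult_right_zero)
  finally show ?thesis by (simp add: prim_add pQ)
qed

lemma locally_integrable_mult_prim_power:
  "locally_integrable w \<Longrightarrow> locally_integrable (\<lambda>t. w t * prim w t ^ n)"
  using locally_integrable_mult_continuous[of w "\<lambda>t. prim w t ^ n"]
  by (simp add: continuous_prim continuous_on_power mult.commute)

text \<open>Integrating by parts, \<open>W\<close> times the primitive of \<open>w * W^n\<close>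
  becomes the primitive of \<open>w * W^(n+1)\<close> with the factor
  \<open>1/(n+1) + 1 = (n+2)/(n+1)\<close>. This replaces the chain rule for powers, as
  \<open>W\<close> is differentiable only almost everywhere.\<close>

lemma prim_power:
  assumes "locally_integrable w"
  shows "prim (\<lambda>t. w t * prim w t ^ n) x = prim w x ^ Suc n / of_nat (Suc n)"
proof (induction n arbitrary: x)
  case (Suc n)
  let ?W = "prim w"
  have "?W x * (?W x ^ Suc n / of_nat (Suc n)) = ?W x * prim (\<lambda>t. w t * ?W t ^ n) x"
    by (simp only: Suc.IH)
  also have "\<dots> = prim (\<lambda>t. w t * (?W t ^ Suc n / of_nat (Suc n)) + ?W t * (w t * ?W t ^ n)) x"
    using prim_mult[OF assms locally_integrable_mult_prim_power[OF assms, of n], of x] by (simp only: Suc.IH)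
  also have "(\<lambda>t. w t * (?W t ^ Suc n / of_nat (Suc n)) + ?W t * (w t * ?W t ^ n)) =
      (\<lambda>t. (of_nat (Suc (Suc n)) / of_nat (Suc n)) * (w t * ?W t ^ Suc n))"
    by (rule ext) (simp add: field_simps del: of_nat_Suc, simp add: algebra_simps)
  finally have "?W x ^ Suc (Suc n) / of_nat (Suc n) =
      (of_nat (Suc (Suc n)) / of_nat (Suc n)) * prim (\<lambda>t. w t * ?W t ^ Suc n) x"
    unfolding prim_cmult by simp
  then show ?case by (simp add: field_simps del: of_nat_Suc power_Suc)
qed simp

section \<open>Series with locally uniform majorants\<close>

lemma continuous_suminf:
  fixes c :: "nat \<Rightarrow> real \<Rightarrow> complex"
  assumes c: "\<And>k. continuous_on UNIV (c k)"
    and M: "\<And>R. summable (M R)" "\<And>k R t. \<bar>t\<bar> \<le> R \<Longrightarrow> norm (c k t) \<le> M R k"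
  shows "continuous_on UNIV (\<lambda>t. \<Sum>k. c k t)"
proof -
  have "isCont (\<lambda>t. \<Sum>k. c k t) x" for x
  proof -
    let ?R = "\<bar>x\<bar> + 1"
    have "continuous_on {-?R..?R} (\<lambda>t. \<Sum>k. c k t)"
    proof (rule uniform_limit_theorem)
      show "uniform_limit {-?R..?R} (\<lambda>n t. \<Sum>k<n. c k t) (\<lambda>t. \<Sum>k. c k t) sequentially"
        by (rule Weierstrass_m_test[OF _ M(1)[of ?R]]) (auto intro!: M(2))
      show "\<forall>\<^sub>F n in sequentially. continuous_on {-?R..?R} (\<lambda>t. \<Sum>k<n. c k t)"
        by (intro always_eventually allI continuous_intros continuous_on_subset[OF c]) auto
    qed simp
    moreover have "x \<in> interior {-?R..?R}" unfolding interior_atLeastAtMost_real by auto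
    ultimately show ?thesis by (rule continuous_on_interior)
  qed
  then show ?thesis by (simp add: continuous_at_imp_continuous_on)
qed

text \<open>The integral of the norm of the \<open>k\<close>-th term is at most \<open>M k\<close>
  times the integral of \<open>norm w\<close> over the interval, so the sum of these integrals
  converges and termwise integration applies. A majorant is available only for
  \<open>\<bar>t\<bar> \<le> \<bar>x\<bar>\<close>; beyond that the indicator makes every term
  zero.\<close>

lemma prim_sums:
  fixes c :: "nat \<Rightarrow> real \<Rightarrow> complex"
  assumes w: "locally_integrable w" and c: "\<And>k. continuous_on UNIV (c k)"
    and M: "summable M" "\<And>k t. \<bar>t\<bar> \<le> \<bar>x\<bar> \<Longrightarrow> norm (c k t) \<le> M k"
  shows "(\<lambda>k. prim (\<lambda>t. w t * c k t) x) sums prim (\<lambda>t. w t * (\<Sum>k. c k t)) x"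
proof -
  obtain \<sigma> :: real where \<sigma>: "\<bar>\<sigma>\<bar> = 1" "0 \<le> \<sigma> * x" by (rule signed_cases)
  let ?I = "indicat_real (signed_interval \<sigma> x)"
  have I: "?I t = 0" if "\<not> \<bar>t\<bar> \<le> \<bar>x\<bar>" for t
    using signed_interval_subset[OF \<sigma>(1), of x] that
    by (metis abs_le_iff atLeastAtMost_iff indicator_simps(2) minus_le_iff subsetD)
  have sm: "summable (\<lambda>k. norm (c k t))" if "\<bar>t\<bar> \<le> \<bar>x\<bar>" for t
    by (rule summable_comparison_test'[OF M(1)]) (use M(2)[OF that] in auto)
  have wc: "locally_integrable (\<lambda>t. w t * c k t)" for k
    using locally_integrable_mult_continuous[OF w c] by (simp add: mult.commute)
  have int: "integrable lebesgue (\<lambda>t. ?I t *\<^sub>R (w t * c k t))" for k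
    by (rule integrable_on_signed_interval[OF wc \<sigma>(1)])
  have intw: "integrable lebesgue (\<lambda>t. ?I t *\<^sub>R w t)"
    by (rule integrable_on_signed_interval[OF w \<sigma>(1)])
  have "(\<lambda>k. \<integral>t. ?I t *\<^sub>R (w t * c k t) \<partial>lebesgue) sums (\<integral>t. (\<Sum>k. ?I t *\<^sub>R (w t * c k t)) \<partial>lebesgue)"
  proof (rule sums_integral[OF int])
    show "AE t in lebesgue. summable (\<lambda>k. norm (?I t *\<^sub>R (w t * c k t)))"
    proof (rule AE_I2)
      fix t show "summable (\<lambda>k. norm (?I t *\<^sub>R (w t * c k t)))"
        using sm[of t] I[of t] by (cases "\<bar>t\<bar> \<le> \<bar>x\<bar>") (simp_all add: norm_mult summable_mult)
    qed
    have "(\<integral>t. norm (?I t *\<^sub>R (w t * c k t)) \<partial>lebesgue) \<le> (\<integral>t. M k * norm (?I t *\<^sub>R w t) \<partial>lebesgue)" for k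
    proof (rule integral_mono)
      fix t show "norm (?I t *\<^sub>R (w t * c k t)) \<le> M k * norm (?I t *\<^sub>R w t)"
      proof (cases "\<bar>t\<bar> \<le> \<bar>x\<bar>")
        case True
        have "norm (?I t *\<^sub>R (w t * c k t)) = norm (c k t) * norm (?I t *\<^sub>R w t)"
          by (simp add: norm_mult)
        also have "\<dots> \<le> M k * norm (?I t *\<^sub>R w t)"
          by (rule mult_right_mono[OF M(2)[OF True]]) simp
        finally show ?thesis .
      qed (simp add: I)
    qed (use int[THEN integrable_norm] intw[THEN integrable_norm] in auto)
    then show "summable (\<lambda>k. \<integral>t. norm (?I t *\<^sub>R (w t * c k t)) \<partial>lebesgue)"
      by (intro summable_comparison_test'[OF summable_mult2[OF M(1), of "\<integral>t. norm (?I t *\<^sub>R w t) \<partial>lebesgue"]]) auto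
  qed
  moreover have "(\<Sum>k. ?I t *\<^sub>R (w t * c k t)) = ?I t *\<^sub>R (w t * (\<Sum>k. c k t))" for t
    using sm[of t, THEN summable_norm_cancel] I[of t]
    by (cases "\<bar>t\<bar> \<le> \<bar>x\<bar>") (simp_all add: suminf_mult suminf_scaleR_right[symmetric] summable_mult)
  ultimately show ?thesis
    unfolding prim_eq_signed[OF \<sigma>] by (simp add: sums_mult)
qed

subsection \<open>Iterated integrals over ordered simplices\<close>

text \<open>The ordered simplex, with the outermost variable \<open>s (Suc j)\<close> peeled off as
  the new endpoint. This is the order in which Fubini's theorem is applied. The sign selects the
  increasing order on the right half-line or the decreasing one on the left.\<close>

primrec chain :: "real \<Rightarrow> nat \<Rightarrow> real \<Rightarrow> (nat \<Rightarrow> real) \<Rightarrow> bool" where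
  "chain \<sigma> 0 x s \<longleftrightarrow> True"
| "chain \<sigma> (Suc j) x s \<longleftrightarrow> s (Suc j) \<in> signed_interval \<sigma> x \<and> chain \<sigma> j (s (Suc j)) s"

lemma chain_bounds:
  "chain \<sigma> j x s \<Longrightarrow> i \<in> {1..j} \<Longrightarrow> s i \<in> signed_interval \<sigma> x"
proof (induction j arbitrary: x)
  case (Suc j)
  show ?case
  proof (cases "i = Suc j")
    case False
    then have "s i \<in> signed_interval \<sigma> (s (Suc j))" using Suc by auto
    then show ?thesis using Suc.prems by (auto simp: signed_interval_def)
  qed (use Suc.prems in auto)
qed simp

lemma chain_iff:
  assumes "1 \<le> j"
  shows "chain \<sigma> j x s \<longleftrightarrow>
    0 < \<sigma> * s 1 \<and> (\<forall>i\<in>{1..<j}. \<sigma> * s i < \<sigma> * s (Suc i)) \<and> \<sigma> * s j < \<sigma> * x"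
  using assms
proof (induction j arbitrary: x rule: nat_induct_at_least)
  case base
  show ?case by (simp add: signed_interval_def)
next
  case (Suc j)
  have "{1..<Suc j} = insert j {1..<j}" using Suc.hyps by auto
  moreover have "0 < \<sigma> * s (Suc j)" if "chain \<sigma> j (s (Suc j)) s"
    using chain_bounds[OF that, of j] Suc.hyps by (auto simp: signed_interval_def)
  ultimately show ?case
    using Suc.IH[of "s (Suc j)"] by (auto simp: signed_interval_def)
qed

lemma chain_cong: "(\<And>i. i \<in> {1..j} \<Longrightarrow> s i = s' i) \<Longrightarrow> chain \<sigma> j x s = chain \<sigma> j x s'"
  by (induction j arbitrary: x) auto

text \<open>The endpoint is a function of the point \<open>s\<close> because the recursion replaces
  it by a coordinate; \<open>n\<close> stays fixed so that the induction on \<open>j\<close> remains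
  in one product space.\<close>

lemma chain_measurable [measurable]:
  assumes "j \<le> n" "f \<in> borel_measurable (PiM {1..n} (\<lambda>_. lebesgue))"
  shows "Measurable.pred (PiM {1..n} (\<lambda>_. lebesgue)) (\<lambda>s. chain \<sigma> j (f s) s)"
  using assms
proof (induction j arbitrary: f)
  case (Suc j)
  note [measurable] = Suc.prems(2)
  have "(\<lambda>s. s (Suc j)) \<in> measurable (PiM {1..n} (\<lambda>_. lebesgue :: real measure)) lebesgue"
    by (rule measurable_component_singleton) (use Suc.prems in auto)
  \<comment> \<open>The projection is measurable into \<open>lebesgue\<close>; comparing coordinates
    requires the Borel sets as target.\<close>
  from measurable_compose[OF this id_measurable_lebesgue]
  have [measurable]: "(\<lambda>s. s (Suc j)) \<in> borel_measurable (PiM {1..n} (\<lambda>_. lebesgue :: real measure))" .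
  have [measurable]: "Measurable.pred (PiM {1..n} (\<lambda>_. lebesgue)) (\<lambda>s. chain \<sigma> j (s (Suc j)) s)"
    by (rule Suc.IH) (use Suc.prems in auto)
  show ?case unfolding chain.simps signed_interval_def mem_Collect_eq by measurable
qed simp

lemma simplex_int_signed:
  assumes "\<bar>\<sigma>\<bar> = 1" "0 \<le> \<sigma> * x"
  shows "simplex_int j u v x = of_real \<sigma> ^ j *
    (\<integral>s. (if chain \<sigma> j x s then alt_prod j u v s else 0) \<partial>PiM {1..j} (\<lambda>_. lebesgue))"
proof (cases "j = 0")
  case True
  \<comment> \<open>The product over the empty index set is a one-point space of mass 1, so the
    integral of the empty product agrees with the separate clause for \<open>j = 0\<close>.\<close>
  then show ?thesis
    by (simp add: simplex_int_def alt_prod_def PiM_empty lebesgue_integral_count_space_finite)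
next
  case False
  then have j: "1 \<le> j" by simp
  consider "\<sigma> = 1" "0 \<le> x" | "\<sigma> = -1" "x < 0" | "\<sigma> = -1" "x = 0"
    using assms by (auto simp: abs_if le_less split: if_splits)
  then show ?thesis
  proof cases
    case 1
    then show ?thesis using False
      by (auto simp: simplex_int_def set_lebesgue_integral_def chain_iff[OF j] intro!: Bochner_Integration.integral_cong)
  next
    case 2
    have "indicat_real {s. x < s j \<and> (\<forall>i\<in>{1..<j}. s (Suc i) < s i) \<and> s 1 < 0} s *\<^sub>R alt_prod j u v s =
        (if chain \<sigma> j x s then alt_prod j u v s else 0)" for s
      unfolding chain_iff[OF j] using 2 by (simp add: indicator_def conj_ac)
    then show ?thesis using False 2
      by (simp add: simplex_int_def set_lebesgue_integral_def)
  next
    \<comment> \<open>Here the definition uses the branch for \<open>0 \<le> x\<close>, which has no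
      factor \<open>(-1)^j\<close>. Both simplices are empty, so the two sides are 0.\<close>
    case 3
    have "\<not> chain \<tau> j 0 s" for \<tau> s
      using chain_bounds[of \<tau> j 0 s j] j by (auto simp: signed_interval_def)
    from this[of 1] this[of \<sigma>] have "\<not> (0 < s 1 \<and> (\<forall>i\<in>{1..<j}. s i < s (Suc i)) \<and> s j < 0)" "\<not> chain \<sigma> j 0 s" for s
      by (simp_all add: chain_iff[OF j])
    then show ?thesis using 3 False
      by (simp add: simplex_int_def set_lebesgue_integral_def)
  qed
qed

lemma simplex_int_0 [simp]: "simplex_int 0 u v x = 1"
  by (simp add: simplex_int_def)

lemma alt_prod_Suc:
  "alt_prod (Suc j) u v s = (if even j then u (s (Suc j)) else v (s (Suc j))) * alt_prod j u v s"
  by (simp add: alt_prod_def mult.commute)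

lemma alt_prod_cong: "(\<And>i. i \<in> {1..j} \<Longrightarrow> s i = s' i) \<Longrightarrow> alt_prod j u v s = alt_prod j u v s'"
  unfolding alt_prod_def by (rule prod.cong) auto

lemma locally_integrable_if:
  "locally_integrable u \<Longrightarrow> locally_integrable v \<Longrightarrow> locally_integrable (\<lambda>t. if b then u t else v t)"
  by (cases b) simp_all

text \<open>The simplex lies in a cube of copies of \<open>signed_interval \<sigma> x\<close>, on
  which the integrand is a product of integrable functions of one variable each.\<close>

lemma integrable_alt_prod_chain:
  assumes u: "locally_integrable u" and v: "locally_integrable v" and \<sigma>: "\<bar>\<sigma>\<bar> = 1"
  shows "integrable (PiM {1..j} (\<lambda>_. lebesgue)) (\<lambda>s. if chain \<sigma> j x s then alt_prod j u v s else 0)"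
proof -
  interpret L: sigma_finite_measure "lebesgue :: real measure" by (rule sigma_finite_lebesgue)
  interpret product_sigma_finite "\<lambda>_::nat. lebesgue :: real measure" ..
  let ?P = "PiM {1..j} (\<lambda>_. lebesgue :: real measure)"
  let ?w = "\<lambda>i t. indicat_real (signed_interval \<sigma> x) t *\<^sub>R (if odd i then u t else v t)"
  have int: "integrable ?P (\<lambda>s. \<Prod>i\<in>{1..j}. ?w i (s i))"
    by (rule product_integrable_prod) (auto intro!: integrable_on_signed_interval locally_integrable_if u v \<sigma>)
  note [measurable] = locally_integrable_measurable[OF u] locally_integrable_measurable[OF v]
  have [measurable]: "(\<lambda>s. alt_prod j u v s) \<in> borel_measurable ?P"
    unfolding alt_prod_def by measurable
  have [measurable]: "Measurable.pred ?P (chain \<sigma> j x)"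
    by (rule chain_measurable) auto
  show ?thesis
  proof (rule Bochner_Integration.integrable_bound[OF int])
    show "AE s in ?P. norm (if chain \<sigma> j x s then alt_prod j u v s else 0) \<le> norm (\<Prod>i\<in>{1..j}. ?w i (s i))"
    proof (rule AE_I2)
      fix s
      have "alt_prod j u v s = (\<Prod>i\<in>{1..j}. ?w i (s i))" if "chain \<sigma> j x s"
        unfolding alt_prod_def by (rule prod.cong) (use chain_bounds[OF that] in auto)
      then show "norm (if chain \<sigma> j x s then alt_prod j u v s else 0) \<le> norm (\<Prod>i\<in>{1..j}. ?w i (s i))"
        by simp
    qed
  qed measurable
qed

text \<open>Fubini with the last variable outermost: the inner integral runs over the simplex of
  dimension \<open>j\<close> that ends at this variable. Continuity is assumed in order to make the
  outer integrand measurable; \<open>continuous_simplex_int\<close> discharges it by induction,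
  using this very recursion.\<close>

lemma simplex_int_Suc_aux:
  assumes u: "locally_integrable u" and v: "locally_integrable v"
    and cont: "continuous_on UNIV (simplex_int j u v)"
  shows "simplex_int (Suc j) u v x = prim (\<lambda>t. (if even j then u t else v t) * simplex_int j u v t) x"
proof -
  obtain \<sigma> :: real where \<sigma>: "\<bar>\<sigma>\<bar> = 1" "0 \<le> \<sigma> * x" by (rule signed_cases)
  have \<sigma>2: "complex_of_real \<sigma> * complex_of_real \<sigma> = 1"
    using \<sigma>(1) by (metis abs_mult_self_eq mult_1 of_real_1 of_real_mult)
  interpret L: sigma_finite_measure "lebesgue :: real measure" by (rule sigma_finite_lebesgue)
  interpret product_sigma_finite "\<lambda>_::nat. lebesgue :: real measure" ..
  let ?w = "\<lambda>t. if even j then u t else v t"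
  let ?J = "{1..j}"
  let ?I = "indicat_real (signed_interval \<sigma> x)"
  define F where "F = (\<lambda>s. if chain \<sigma> (Suc j) x s then alt_prod (Suc j) u v s else 0)"
  \<comment> \<open>Since \<open>\<sigma>^j * \<sigma>^j = 1\<close>, the unsigned integral over the
    simplex is \<open>\<sigma>^j\<close> times \<open>simplex_int j\<close>.\<close>
  define G where "G = (\<lambda>t. ?I t *\<^sub>R (?w t * (of_real \<sigma> ^ j * simplex_int j u v t)))"
  have ins: "{1..Suc j} = {Suc j} \<union> ?J" by auto
  have F: "F (merge {Suc j} ?J (y, z)) =
      ?I (y (Suc j)) *\<^sub>R (?w (y (Suc j)) * (if chain \<sigma> j (y (Suc j)) z then alt_prod j u v z else 0))" for y z
  proof -
    let ?m = "merge {Suc j} ?J (y, z)"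
    have m: "?m (Suc j) = y (Suc j)" "\<And>i. i \<in> ?J \<Longrightarrow> ?m i = z i"
      by (auto simp: merge_def)
    show ?thesis
      using chain_cong[of j ?m z] alt_prod_cong[of j ?m z] m
      by (simp add: F_def alt_prod_Suc indicator_def)
  qed
  have inner: "(\<integral>z. F (merge {Suc j} ?J (y, z)) \<partial>PiM ?J (\<lambda>_. lebesgue)) = G (y (Suc j))" for y
  proof (cases "y (Suc j) \<in> signed_interval \<sigma> x")
    case True
    then have y: "0 \<le> \<sigma> * y (Suc j)" by (simp add: signed_interval_def)
    have "complex_of_real \<sigma> ^ j * complex_of_real \<sigma> ^ j = 1"
      by (simp add: \<sigma>2 flip: power_mult_distrib)
    then have "of_real \<sigma> ^ j * simplex_int j u v (y (Suc j)) =
        (\<integral>z. (if chain \<sigma> j (y (Suc j)) z then alt_prod j u v z else 0) \<partial>PiM ?J (\<lambda>_. lebesgue))"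
      unfolding simplex_int_signed[OF \<sigma>(1) y] mult.assoc[symmetric] by simp
    then show ?thesis
      unfolding F G_def using True by (simp only: indicator_simps scaleR_one integral_mult_right_zero)
  next
    case False
    then show ?thesis unfolding F G_def by simp
  qed
  note [measurable] = locally_integrable_measurable[OF u] locally_integrable_measurable[OF v]
  have [measurable]: "simplex_int j u v \<in> borel_measurable lebesgue"
    by (rule measurable_completion) (simp add: borel_measurable_continuous_onI cont)
  have [measurable]: "G \<in> borel_measurable lebesgue"
    unfolding G_def by measurable
  have "integral\<^sup>L (PiM {1..Suc j} (\<lambda>_. lebesgue)) F =
      (\<integral>y. (\<integral>z. F (merge {Suc j} ?J (y, z)) \<partial>PiM ?J (\<lambda>_. lebesgue)) \<partial>PiM {Suc j} (\<lambda>_. lebesgue))"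
    unfolding ins
  proof (rule product_integral_fold)
    show "integrable (PiM ({Suc j} \<union> ?J) (\<lambda>_. lebesgue)) F"
      unfolding ins[symmetric] F_def by (rule integrable_alt_prod_chain[OF u v \<sigma>(1)])
  qed auto
  also have "\<dots> = (\<integral>t. G t \<partial>lebesgue)"
    unfolding inner by (rule product_integral_singleton) measurable
  also have "\<dots> = of_real \<sigma> ^ j * (\<integral>t. ?I t *\<^sub>R (?w t * simplex_int j u v t) \<partial>lebesgue)"
    unfolding G_def by (simp add: mult.left_commute flip: integral_mult_right_zero)
  finally have "simplex_int (Suc j) u v x = of_real \<sigma> ^ Suc j *
      (of_real \<sigma> ^ j * (\<integral>t. ?I t *\<^sub>R (?w t * simplex_int j u v t) \<partial>lebesgue))"
    unfolding simplex_int_signed[OF \<sigma>] F_def by simp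
  also have "\<dots> = (complex_of_real \<sigma> * complex_of_real \<sigma>) ^ j * (of_real \<sigma> * (\<integral>t. ?I t *\<^sub>R (?w t * simplex_int j u v t) \<partial>lebesgue))"
    by (simp add: power_mult_distrib mult_ac)
  also have "\<dots> = prim (\<lambda>t. ?w t * simplex_int j u v t) x"
    by (simp add: \<sigma>2 prim_eq_signed[OF \<sigma>])
  finally show ?thesis .
qed

lemma continuous_simplex_int:
  assumes "locally_integrable u" "locally_integrable v"
  shows "continuous_on UNIV (simplex_int j u v)"
proof (induction j)
  case 0
  have "simplex_int 0 u v = (\<lambda>x. 1)" by (rule ext) simp
  then show ?case by simp
next
  case (Suc j)
  have "locally_integrable (\<lambda>t. (if even j then u t else v t) * simplex_int j u v t)"
    using locally_integrable_mult_continuous[OF locally_integrable_if[OF assms, of "even j"] Suc]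
    by (simp only: mult.commute)
  from continuous_prim[OF this] show ?case
    by (simp add: simplex_int_Suc_aux[OF assms Suc, abs_def])
qed

lemmas simplex_int_Suc = simplex_int_Suc_aux[OF _ _ continuous_simplex_int]

text \<open>Majorizing both \<open>u\<close> and \<open>v\<close> by the sum of their norms makes
  the weight the same at each step, so the majorant \<open>w * W^j / fact j\<close> of the integrand
  in the recursion is integrated exactly by \<open>prim_power\<close>.\<close>

lemma simplex_int_bound:
  assumes u: "locally_integrable u" and v: "locally_integrable v"
  defines "W \<equiv> prim (\<lambda>t. of_real (norm (u t)) + of_real (norm (v t)))"
  shows "norm (simplex_int j u v x) \<le> norm (W x) ^ j / fact j"
proof (induction j arbitrary: x)
  case (Suc j)
  let ?w = "\<lambda>t. complex_of_real (norm (u t)) + of_real (norm (v t))"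
  let ?a = "\<lambda>t. if even j then u t else v t"
  have w: "locally_integrable ?w"
    by (intro locally_integrable_add locally_integrable_norm u v)
  obtain \<sigma> :: real where \<sigma>: "\<bar>\<sigma>\<bar> = 1" "0 \<le> \<sigma> * x" by (rule signed_cases)
  \<comment> \<open>\<open>W\<close> is real and has the sign \<open>\<sigma>\<close> on this
    half-line, so \<open>W^j\<close> has the phase \<open>\<sigma>^j\<close>, which the choice
    \<open>c = \<sigma>^j\<close> below removes.\<close>
  have Wt: "W t = of_real (\<sigma> * norm (W t))" if "0 \<le> \<sigma> * t" for t
  proof -
    have "W t = of_real \<sigma> * of_real (\<integral>s. indicat_real (signed_interval \<sigma> t) s * (norm (u s) + norm (v s)) \<partial>lebesgue)"
      unfolding W_def prim_eq_signed[OF \<sigma>(1) that] integral_complex_of_real[symmetric]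
      by (simp add: scaleR_conv_of_real)
    moreover have "0 \<le> (\<integral>s. indicat_real (signed_interval \<sigma> t) s * (norm (u s) + norm (v s)) \<partial>lebesgue)"
      by (intro Bochner_Integration.integral_nonneg) simp
    ultimately show ?thesis using \<sigma>(1) by (simp add: norm_mult)
  qed
  have W: "locally_integrable (\<lambda>t. ?w t * W t ^ j)"
    unfolding W_def by (rule locally_integrable_mult_prim_power[OF w])
  have "norm (simplex_int (Suc j) u v x) = norm (prim (\<lambda>t. ?a t * simplex_int j u v t) x)"
    by (simp add: simplex_int_Suc u v)
  also have "\<dots> \<le> norm (prim (\<lambda>t. (1 / fact j) * (?w t * W t ^ j)) x)"
  proof (rule norm_prim_le[where c = "of_real \<sigma> ^ j"])
    show "locally_integrable (\<lambda>t. ?a t * simplex_int j u v t)"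
      using locally_integrable_mult_continuous[OF locally_integrable_if[OF u v, of "even j"] continuous_simplex_int[OF u v, of j]]
      by (simp only: mult.commute)
    show "locally_integrable (\<lambda>t. (1 / fact j) * (?w t * W t ^ j))"
      by (rule locally_integrable_mult_continuous[OF W]) simp
    show "norm (complex_of_real \<sigma> ^ j) = 1" using \<sigma>(1) by (simp add: norm_power)
    fix t assume "t \<in> closed_segment 0 x"
    then have t: "0 \<le> \<sigma> * t"
      using \<sigma> by (auto simp: closed_segment_eq_real_ivl abs_if split: if_splits)
    have "\<sigma> * \<sigma> = 1" using \<sigma>(1) abs_mult_self_eq[of \<sigma>] by simp
    then have "\<sigma> ^ j * \<sigma> ^ j = 1" by (simp flip: power_mult_distrib)
    then have sgn: "complex_of_real \<sigma> ^ j * complex_of_real \<sigma> ^ j = 1"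
      by (metis of_real_1 of_real_mult of_real_power)
    define m where "m = norm (W t)"
    have Wm: "W t = of_real \<sigma> * of_real m"
      using Wt[OF t] by (simp only: m_def of_real_mult)
    have "of_real \<sigma> ^ j * ((1 / fact j) * (?w t * W t ^ j)) =
        (complex_of_real \<sigma> ^ j * complex_of_real \<sigma> ^ j) * (?w t * (of_real m ^ j / fact j))"
      unfolding Wm by (simp add: power_mult_distrib field_simps)
    then have "of_real \<sigma> ^ j * ((1 / fact j) * (?w t * W t ^ j)) =
        complex_of_real ((norm (u t) + norm (v t)) * (norm (W t) ^ j / fact j))"
      unfolding sgn m_def by simp
    moreover have "norm (?a t * simplex_int j u v t) \<le> (norm (u t) + norm (v t)) * (norm (W t) ^ j / fact j)"
      unfolding norm_mult by (intro mult_mono Suc.IH) auto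
    ultimately show "norm (?a t * simplex_int j u v t) \<le> Re (of_real \<sigma> ^ j * ((1 / fact j) * (?w t * W t ^ j)))"
      by (simp only: Re_complex_of_real)
  qed
  also have "\<dots> = norm (W x) ^ Suc j / fact (Suc j)"
    unfolding prim_cmult using prim_power[OF w, of j x]
    by (simp add: W_def norm_mult norm_divide norm_power del: of_nat_Suc)
  finally show ?case .
qed simp

text \<open>\<open>K\<close> bounds the continuous function \<open>W\<close> on the compact
  interval, and the majorants are the terms of the series for \<open>exp K\<close>.\<close>

lemma simplex_int_summable_bound:
  assumes u: "locally_integrable u" and v: "locally_integrable v"
  shows "\<exists>M. summable M \<and> (\<forall>j t. \<bar>t\<bar> \<le> R \<longrightarrow> norm (simplex_int j u v t) \<le> M j)"
proof -
  let ?W = "prim (\<lambda>t. of_real (norm (u t)) + of_real (norm (v t)))"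
  have "continuous_on {-R..R} ?W"
    by (intro continuous_on_subset[OF continuous_prim] locally_integrable_add locally_integrable_norm u v) auto
  then have "bounded (?W ` {-R..R})"
    by (intro compact_imp_bounded compact_continuous_image) auto
  then obtain K where K: "\<And>t. t \<in> {-R..R} \<Longrightarrow> norm (?W t) \<le> K"
    unfolding bounded_iff by blast
  show ?thesis
  proof (intro exI[of _ "\<lambda>j. K ^ j / fact j"] conjI allI impI)
    show "summable (\<lambda>j. K ^ j / fact j)"
      using summable_exp[of K] by (simp add: divide_inverse mult.commute)
    fix j t assume "\<bar>t\<bar> \<le> R"
    then have "norm (?W t) \<le> K" by (intro K) (auto simp: abs_le_iff)
    then have "norm (?W t) ^ j / fact j \<le> K ^ j / fact j"
      by (intro divide_right_mono power_mono) auto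
    then show "norm (simplex_int j u v t) \<le> K ^ j / fact j"
      using simplex_int_bound[OF u v, of j t] by linarith
  qed
qed

subsection \<open>Bivariate hyperbolic functions\<close>

text \<open>Homogeneity of degree \<open>j\<close> in the pair \<open>(u, v)\<close>: this is why
  the half-sum and half-difference of the two exponentials isolate the even and the odd
  terms.\<close>

lemma simplex_int_uminus:
  assumes "locally_integrable u" "locally_integrable v"
  shows "simplex_int j (\<lambda>t. - u t) (\<lambda>t. - v t) x = (-1) ^ j * simplex_int j u v x"
proof (induction j arbitrary: x)
  case (Suc j)
  have "simplex_int (Suc j) (\<lambda>t. - u t) (\<lambda>t. - v t) x =
      prim (\<lambda>t. (if even j then - u t else - v t) * ((-1) ^ j * simplex_int j u v t)) x"
    by (simp only: simplex_int_Suc locally_integrable_minus assms Suc.IH)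
  also have "\<dots> = prim (\<lambda>t. (-1) ^ Suc j * ((if even j then u t else v t) * simplex_int j u v t)) x"
    by (rule arg_cong[where f = "\<lambda>w. prim w x"]) (auto simp: fun_eq_iff)
  finally show ?case by (simp only: prim_cmult simplex_int_Suc assms)
qed simp

lemma summable_simplex_int:
  assumes "locally_integrable u" "locally_integrable v"
  shows "summable (\<lambda>j. simplex_int j u v x)"
proof -
  obtain M where M: "summable M" "\<forall>j t. \<bar>t\<bar> \<le> \<bar>x\<bar> \<longrightarrow> norm (simplex_int j u v t) \<le> M j"
    using simplex_int_summable_bound[OF assms] by blast
  show ?thesis by (rule summable_comparison_test'[OF M(1), of 0]) (use M(2) in auto)
qed

lemma biv_exp_eq_suminf:
  assumes "locally_integrable u" "locally_integrable v"
  shows "biv_exp u v x = (\<Sum>j. simplex_int j u v x)"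
  using suminf_split_head[OF summable_simplex_int[OF assms]] by (simp add: biv_exp_def)

lemma
  assumes u: "locally_integrable u" and v: "locally_integrable v"
  shows biv_cosh_eq_suminf: "biv_cosh u v x = (\<Sum>j. if even j then simplex_int j u v x else 0)"
    and biv_sinh_eq_suminf: "biv_sinh u v x = (\<Sum>j. if even j then 0 else simplex_int j u v x)"
proof -
  note s = summable_simplex_int[OF u v, of x]
  have s': "summable (\<lambda>j. simplex_int j (\<lambda>t. - u t) (\<lambda>t. - v t) x)"
    by (intro summable_simplex_int locally_integrable_minus u v)
  note e = biv_exp_eq_suminf[OF u v, of x]
    biv_exp_eq_suminf[OF locally_integrable_minus[OF u] locally_integrable_minus[OF v], of x]
  have "biv_cosh u v x = (\<Sum>j. (simplex_int j u v x + simplex_int j (\<lambda>t. - u t) (\<lambda>t. - v t) x) / 2)"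
    unfolding biv_cosh_def e suminf_add[OF s s'] by (rule suminf_divide[OF summable_add[OF s s'], symmetric])
  also have "(\<lambda>j. (simplex_int j u v x + simplex_int j (\<lambda>t. - u t) (\<lambda>t. - v t) x) / 2) =
      (\<lambda>j. if even j then simplex_int j u v x else 0)"
    unfolding simplex_int_uminus[OF u v] by (auto simp: fun_eq_iff)
  finally show "biv_cosh u v x = (\<Sum>j. if even j then simplex_int j u v x else 0)" .
  have "biv_sinh u v x = (\<Sum>j. (simplex_int j u v x - simplex_int j (\<lambda>t. - u t) (\<lambda>t. - v t) x) / 2)"
    unfolding biv_sinh_def e suminf_diff[OF s s'] by (rule suminf_divide[OF summable_diff[OF s s'], symmetric])
  also have "(\<lambda>j. (simplex_int j u v x - simplex_int j (\<lambda>t. - u t) (\<lambda>t. - v t) x) / 2) =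
      (\<lambda>j. if even j then 0 else simplex_int j u v x)"
    unfolding simplex_int_uminus[OF u v] by (auto simp: fun_eq_iff)
  finally show "biv_sinh u v x = (\<Sum>j. if even j then 0 else simplex_int j u v x)" .
qed

text \<open>The recursion raises the degree by one and swaps parity, with weight \<open>u\<close> on
  even terms and \<open>v\<close> on odd ones, so each of the two series is carried into the other.
  The constant 1 is the term of degree 0, which has no predecessor.\<close>

lemma
  assumes u: "locally_integrable u" and v: "locally_integrable v"
  shows continuous_biv_cosh: "continuous_on UNIV (biv_cosh u v)"
    and continuous_biv_sinh: "continuous_on UNIV (biv_sinh u v)"
    and biv_cosh_eq_prim: "biv_cosh u v x = 1 + prim (\<lambda>t. v t * biv_sinh u v t) x"
    and biv_sinh_eq_prim: "biv_sinh u v x = prim (\<lambda>t. u t * biv_cosh u v t) x"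
proof -
  \<comment> \<open>Padding with zeros keeps the index \<open>j\<close> of
    \<open>simplex_int\<close>, so that both series share the majorant \<open>M\<close>.\<close>
  define a where "a = (\<lambda>j t. if even j then simplex_int j u v t else 0)"
  define b where "b = (\<lambda>j t. if even j then 0 else simplex_int j u v t)"
  have C: "biv_cosh u v = (\<lambda>t. \<Sum>j. a j t)" and S: "biv_sinh u v = (\<lambda>t. \<Sum>j. b j t)"
    unfolding a_def b_def by (intro ext biv_cosh_eq_suminf biv_sinh_eq_suminf u v)+
  obtain M where M: "\<And>R. summable (M R)" "\<And>R j t. \<bar>t\<bar> \<le> R \<Longrightarrow> norm (simplex_int j u v t) \<le> M R j"
    using simplex_int_summable_bound[OF u v] by metis
  have M0: "0 \<le> M R j" if "\<bar>t\<bar> \<le> R" for R j t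
    using M(2)[OF that, of j] norm_ge_zero order_trans by blast
  have ab: "norm (a j t) \<le> M R j" "norm (b j t) \<le> M R j" if "\<bar>t\<bar> \<le> R" for R j t
    using M(2)[OF that] M0[OF that] by (auto simp: a_def b_def)
  have cont: "continuous_on UNIV (a j)" "continuous_on UNIV (b j)" for j
    unfolding a_def b_def by (cases "even j"; simp add: continuous_simplex_int u v)+
  show "continuous_on UNIV (biv_cosh u v)" "continuous_on UNIV (biv_sinh u v)"
    unfolding C S by (rule continuous_suminf[OF cont(1) M(1) ab(1)] continuous_suminf[OF cont(2) M(1) ab(2)]; assumption)+
  \<comment> \<open>Covers the padded indices, at which the recursion only says that 0 is the
    primitive of 0.\<close>
  have [simp]: "prim (\<lambda>t. 0) x = 0" for x
    using prim_cmult[of 0 "\<lambda>t. 0"] by simp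
  have rec: "a (Suc j) x = prim (\<lambda>t. v t * b j t) x" "b (Suc j) x = prim (\<lambda>t. u t * a j t) x" for j x
    unfolding a_def b_def by (cases "even j"; simp add: simplex_int_Suc u v)+
  have sums: "summable (\<lambda>j. a j x)" "summable (\<lambda>j. b j x)"
    by (rule summable_comparison_test'[OF M(1)[of "\<bar>x\<bar>"]], use ab in simp)+
  have split: "(\<Sum>j. a j x) = 1 + (\<Sum>j. a (Suc j) x)" "(\<Sum>j. b j x) = (\<Sum>j. b (Suc j) x)"
    using suminf_split_head[OF sums(1)] suminf_split_head[OF sums(2)] by (simp_all add: a_def b_def)
  have "(\<lambda>j. a (Suc j) x) sums prim (\<lambda>t. v t * biv_sinh u v t) x"
    unfolding rec S by (rule prim_sums[OF v cont(2) M(1) ab(2)])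
  then show "biv_cosh u v x = 1 + prim (\<lambda>t. v t * biv_sinh u v t) x"
    unfolding C split by (simp only: sums_unique[symmetric])
  have "(\<lambda>j. b (Suc j) x) sums prim (\<lambda>t. u t * biv_cosh u v t) x"
    unfolding rec C by (rule prim_sums[OF u cont(1) M(1) ab(1)])
  then show "biv_sinh u v x = prim (\<lambda>t. u t * biv_cosh u v t) x"
    unfolding S split by (simp only: sums_unique[symmetric])
qed

subsection \<open>Stability of local absolute continuity\<close>

text \<open>A common criterion for products, exponentials and affine images: absolute continuity
  passes to any function whose increments are controlled by those of two absolutely continuous
  ones.\<close>

lemma abs_continuous_on_interval_compare:
  assumes "abs_continuous_on_interval a b \<phi>" "abs_continuous_on_interval a b \<psi>"
    and le: "\<And>s t. s \<in> {a..b} \<Longrightarrow> t \<in> {a..b} \<Longrightarrow>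
      norm (\<omega> t - \<omega> s) \<le> K * (norm (\<phi> t - \<phi> s) + norm (\<psi> t - \<psi> s))"
  shows "abs_continuous_on_interval a b \<omega>"
  unfolding abs_continuous_on_interval_def
proof (intro allI impI)
  fix \<epsilon> :: real assume "\<epsilon> > 0"
  \<comment> \<open>Each of the two sums receives half of \<open>\<epsilon>\<close>;
    \<open>\<bar>K\<bar> + 1\<close> is positive whatever the value of \<open>K\<close>.\<close>
  let ?e = "\<epsilon> / (2 * (\<bar>K\<bar> + 1))"
  have "?e > 0" using \<open>\<epsilon> > 0\<close> by simp
  define Q where "Q = (\<lambda>\<delta> (n::nat) l r. (\<forall>i<n. a \<le> l i \<and> l i \<le> r i \<and> r i \<le> b) \<and>
      disjoint_family_on (\<lambda>i. {l i<..<r i}) {..<n} \<and> (\<Sum>i<n. r i - l i) < \<delta>)"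
  have Q: "\<exists>\<delta>>0. \<forall>n l r. Q \<delta> n l r \<longrightarrow> (\<Sum>i<n. norm (\<theta> (r i) - \<theta> (l i))) < ?e"
    if "abs_continuous_on_interval a b \<theta>" for \<theta>
    using that[unfolded abs_continuous_on_interval_def, THEN spec, THEN mp, OF \<open>?e > 0\<close>]
    unfolding Q_def .
  obtain \<delta>1 where d1: "\<delta>1 > 0" "\<forall>n l r. Q \<delta>1 n l r \<longrightarrow> (\<Sum>i<n. norm (\<phi> (r i) - \<phi> (l i))) < ?e"
    using Q[OF assms(1)] by blast
  obtain \<delta>2 where d2: "\<delta>2 > 0" "\<forall>n l r. Q \<delta>2 n l r \<longrightarrow> (\<Sum>i<n. norm (\<psi> (r i) - \<psi> (l i))) < ?e"
    using Q[OF assms(2)] by blast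
  note d = d1(1) d2(1) and 1 = d1(2)[rule_format] and 2 = d2(2)[rule_format]
  have half: "k * (\<epsilon> / (2 * k) + \<epsilon> / (2 * k)) = \<epsilon>" if "k > 0" for k :: real
    using that by simp
  have "(\<Sum>i<n. norm (\<omega> (r i) - \<omega> (l i))) < \<epsilon>" if H: "Q (min \<delta>1 \<delta>2) n l r" for n l r
  proof -
    have lr: "l i \<in> {a..b}" "r i \<in> {a..b}" if "i < n" for i
      using H that unfolding Q_def by fastforce+
    have "(\<Sum>i<n. norm (\<omega> (r i) - \<omega> (l i))) \<le> (\<Sum>i<n. (\<bar>K\<bar> + 1) * (norm (\<phi> (r i) - \<phi> (l i)) + norm (\<psi> (r i) - \<psi> (l i))))"
    proof (rule sum_mono)
      fix i assume "i \<in> {..<n}"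
      then have "norm (\<omega> (r i) - \<omega> (l i)) \<le> K * (norm (\<phi> (r i) - \<phi> (l i)) + norm (\<psi> (r i) - \<psi> (l i)))"
        using le lr by simp
      also have "\<dots> \<le> (\<bar>K\<bar> + 1) * (norm (\<phi> (r i) - \<phi> (l i)) + norm (\<psi> (r i) - \<psi> (l i)))"
        by (rule mult_right_mono) auto
      finally show "norm (\<omega> (r i) - \<omega> (l i)) \<le> \<dots>" .
    qed
    also have "\<dots> = (\<bar>K\<bar> + 1) * ((\<Sum>i<n. norm (\<phi> (r i) - \<phi> (l i))) + (\<Sum>i<n. norm (\<psi> (r i) - \<psi> (l i))))"
      by (simp only: sum_distrib_left[symmetric] sum.distrib)
    also have "\<dots> < (\<bar>K\<bar> + 1) * (?e + ?e)"
      using 1[of n l r] 2[of n l r] H by (intro mult_strict_left_mono add_strict_mono) (auto simp: Q_def)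
    also have "\<dots> = \<epsilon>" by (rule half) (simp add: add_nonneg_pos)
    finally show ?thesis .
  qed
  then have "\<forall>n l r. Q (min \<delta>1 \<delta>2) n l r \<longrightarrow> (\<Sum>i<n. norm (\<omega> (r i) - \<omega> (l i))) < \<epsilon>"
    by blast
  moreover have "min \<delta>1 \<delta>2 > 0" using d by simp
  ultimately have "\<exists>\<delta>>0. \<forall>n l r. Q \<delta> n l r \<longrightarrow> (\<Sum>i<n. norm (\<omega> (r i) - \<omega> (l i))) < \<epsilon>"
    by blast
  then show "\<exists>\<delta>>0. \<forall>(n::nat) (l::nat \<Rightarrow> real) r. (\<forall>i<n. a \<le> l i \<and> l i \<le> r i \<and> r i \<le> b) \<and>
      disjoint_family_on (\<lambda>i. {l i<..<r i}) {..<n} \<and> (\<Sum>i<n. r i - l i) < \<delta> \<longrightarrow>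
      (\<Sum>i<n. norm (\<omega> (r i) - \<omega> (l i))) < \<epsilon>"
    unfolding Q_def .
qed

lemma continuous_bounded_on_interval:
  fixes \<phi> :: "real \<Rightarrow> complex"
  assumes "continuous_on UNIV \<phi>"
  obtains B where "B \<ge> 0" "\<And>t. t \<in> {a..b} \<Longrightarrow> norm (\<phi> t) \<le> B"
proof -
  have "bounded (\<phi> ` {a..b})"
    by (intro compact_imp_bounded compact_continuous_image continuous_on_subset[OF assms]) auto
  then show ?thesis using that unfolding bounded_pos by (metis image_eqI less_imp_le)
qed

lemma locally_abs_continuous_mult:
  assumes \<phi>: "locally_abs_continuous \<phi>" "continuous_on UNIV \<phi>"
    and \<psi>: "locally_abs_continuous \<psi>" "continuous_on UNIV \<psi>"
  shows "locally_abs_continuous (\<lambda>x. \<phi> x * \<psi> x)"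
  unfolding locally_abs_continuous_def
proof (intro allI)
  fix a b :: real
  obtain A where A: "A \<ge> 0" "\<And>t. t \<in> {a..b} \<Longrightarrow> norm (\<phi> t) \<le> A"
    using continuous_bounded_on_interval[OF \<phi>(2)] by blast
  obtain B where B: "B \<ge> 0" "\<And>t. t \<in> {a..b} \<Longrightarrow> norm (\<psi> t) \<le> B"
    using continuous_bounded_on_interval[OF \<psi>(2)] by blast
  show "abs_continuous_on_interval a b (\<lambda>x. \<phi> x * \<psi> x)"
  proof (rule abs_continuous_on_interval_compare)
    show "abs_continuous_on_interval a b \<phi>" "abs_continuous_on_interval a b \<psi>"
      using \<phi> \<psi> by (auto simp: locally_abs_continuous_def)
    fix s t assume st: "s \<in> {a..b}" "t \<in> {a..b}"
    have "\<phi> t * \<psi> t - \<phi> s * \<psi> s = \<phi> t * (\<psi> t - \<psi> s) + \<psi> s * (\<phi> t - \<phi> s)"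
      by (simp add: algebra_simps)
    then have "norm (\<phi> t * \<psi> t - \<phi> s * \<psi> s) \<le> norm (\<phi> t) * norm (\<psi> t - \<psi> s) + norm (\<psi> s) * norm (\<phi> t - \<phi> s)"
      by (metis norm_mult norm_triangle_ineq)
    also have "\<dots> \<le> (A + B) * norm (\<psi> t - \<psi> s) + (A + B) * norm (\<phi> t - \<phi> s)"
      using A B st by (intro add_mono mult_right_mono) (auto intro: add_increasing add_increasing2)
    finally show "norm (\<phi> t * \<psi> t - \<phi> s * \<psi> s) \<le> (A + B) * (norm (\<phi> t - \<phi> s) + norm (\<psi> t - \<psi> s))"
      by (simp add: algebra_simps)
  qed
qed

text \<open>On a compact interval \<open>\<phi>\<close> stays in a disc of radius \<open>A\<close>;
  the disc is convex and the derivative of \<open>exp\<close> is bounded there by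
  \<open>exp A\<close>, so \<open>exp\<close> is Lipschitz on it.\<close>

lemma locally_abs_continuous_exp:
  assumes \<phi>: "locally_abs_continuous \<phi>" "continuous_on UNIV \<phi>"
  shows "locally_abs_continuous (\<lambda>x. exp (\<phi> x))"
  unfolding locally_abs_continuous_def
proof (intro allI)
  fix a b :: real
  obtain A where A: "A \<ge> 0" "\<And>t. t \<in> {a..b} \<Longrightarrow> norm (\<phi> t) \<le> A"
    using continuous_bounded_on_interval[OF \<phi>(2)] by blast
  have AC: "abs_continuous_on_interval a b \<phi>" using \<phi> by (auto simp: locally_abs_continuous_def)
  show "abs_continuous_on_interval a b (\<lambda>x. exp (\<phi> x))"
  proof (rule abs_continuous_on_interval_compare[OF AC AC, where K = "exp A"])
    fix s t assume st: "s \<in> {a..b}" "t \<in> {a..b}"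
    have "norm (exp (\<phi> t) - exp (\<phi> s)) \<le> exp A * norm (\<phi> t - \<phi> s)"
    proof (rule field_differentiable_bound[of "cball 0 A"])
      show "norm (exp z) \<le> exp A" if "z \<in> cball 0 A" for z :: complex
        using that complex_Re_le_cmod[of z] by (auto simp: norm_exp_eq_Re)
    qed (use A st in \<open>auto intro!: derivative_eq_intros\<close>)
    then show "norm (exp (\<phi> t) - exp (\<phi> s)) \<le> exp A * (norm (\<phi> t - \<phi> s) + norm (\<phi> t - \<phi> s))"
      by (smt (verit) exp_gt_zero mult_left_mono norm_ge_zero)
  qed
qed

lemma locally_abs_continuous_affine:
  assumes "locally_abs_continuous \<phi>"
  shows "locally_abs_continuous (\<lambda>x. c + d * \<phi> x)"
  unfolding locally_abs_continuous_def
proof (intro allI)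
  fix a b :: real
  have AC: "abs_continuous_on_interval a b \<phi>" using assms by (auto simp: locally_abs_continuous_def)
  show "abs_continuous_on_interval a b (\<lambda>x. c + d * \<phi> x)"
  proof (rule abs_continuous_on_interval_compare[OF AC AC, where K = "norm d"])
    fix s t
    have "norm (c + d * \<phi> t - (c + d * \<phi> s)) = norm d * norm (\<phi> t - \<phi> s)"
      by (simp flip: norm_mult add: algebra_simps)
    then show "norm (c + d * \<phi> t - (c + d * \<phi> s)) \<le> norm d * (norm (\<phi> t - \<phi> s) + norm (\<phi> t - \<phi> s))"
      by (simp add: mult_left_mono)
  qed
qed

subsection \<open>The linear system\<close>

lemma has_vector_derivative_vec:
  fixes f :: "real \<Rightarrow> 'a::real_normed_vector ^ 'n"
  assumes "\<And>i. ((\<lambda>x. f x $ i) has_vector_derivative D $ i) (at x)"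
  shows "(f has_vector_derivative D) (at x)"
  unfolding has_vector_derivative_def has_derivative_within
proof (intro conjI bounded_linear_scaleR_left vec_tendstoI)
  fix i
  show "((\<lambda>y. ((1 / norm (y - x)) *\<^sub>R (f y - (f x + (y - x) *\<^sub>R D))) $ i) \<longlongrightarrow> 0 $ i) (at x)"
    using assms[of i] unfolding has_vector_derivative_def has_derivative_within by simp
qed

text \<open>Integration by parts for functions with prescribed values at 0: \<open>biv_cosh\<close>
  starts from 1, \<open>biv_sinh\<close> from 0.\<close>

lemma mult_prim_affine:
  assumes p: "locally_integrable p" and q: "locally_integrable q"
    and \<phi>: "\<And>t. \<phi> t = c + prim p t" and \<psi>: "\<And>t. \<psi> t = d + prim q t"
  shows "\<phi> x * \<psi> x = c * d + prim (\<lambda>t. p t * \<psi> t + \<phi> t * q t) x"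
proof -
  have i: "locally_integrable (\<lambda>t. p t * prim q t + prim p t * q t)"
    using locally_integrable_mult_continuous[OF p continuous_prim[OF q]]
      locally_integrable_mult_continuous[OF q continuous_prim[OF p]]
    by (intro locally_integrable_add) (simp_all add: mult.commute)
  have i': "locally_integrable (\<lambda>t. d * p t)" "locally_integrable (\<lambda>t. c * q t)"
    by (simp_all add: locally_integrable_mult_continuous p q)
  have "prim (\<lambda>t. p t * \<psi> t + \<phi> t * q t) x =
      prim (\<lambda>t. (p t * prim q t + prim p t * q t) + (d * p t + c * q t)) x"
    by (rule arg_cong[where f = "\<lambda>w. prim w x"]) (simp add: fun_eq_iff \<phi> \<psi> algebra_simps)
  also have "\<dots> = prim p x * prim q x + (d * prim p x + c * prim q x)"
    by (simp add: prim_add prim_cmult i i' locally_integrable_add prim_mult[OF p q])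
  finally show ?thesis by (simp add: \<phi> \<psi> algebra_simps)
qed

text \<open>The analogue of \<open>cosh^2 - sinh^2 = 1\<close>. The constant is read off from the
  initial values \<open>1 * 1\<close> and \<open>0 * 0\<close>.\<close>

lemma biv_cosh_sinh_identity:
  assumes u: "locally_integrable u" and v: "locally_integrable v"
  shows "biv_cosh u v x * biv_cosh v u x - biv_sinh u v x * biv_sinh v u x = 1"
proof -
  have i: "locally_integrable (\<lambda>t. v t * biv_sinh u v t)" "locally_integrable (\<lambda>t. u t * biv_cosh u v t)"
    "locally_integrable (\<lambda>t. u t * biv_sinh v u t)" "locally_integrable (\<lambda>t. v t * biv_cosh v u t)"
    using locally_integrable_mult_continuous continuous_biv_cosh continuous_biv_sinh u v
    by (simp_all add: mult.commute)
  have C: "biv_cosh u v x * biv_cosh v u x = 1 * 1 +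
      prim (\<lambda>t. v t * biv_sinh u v t * biv_cosh v u t + biv_cosh u v t * (u t * biv_sinh v u t)) x"
    by (rule mult_prim_affine[OF i(1) i(3)]) (rule biv_cosh_eq_prim u v)+
  have S: "biv_sinh u v x * biv_sinh v u x = 0 * 0 +
      prim (\<lambda>t. u t * biv_cosh u v t * biv_sinh v u t + biv_sinh u v t * (v t * biv_cosh v u t)) x"
    by (rule mult_prim_affine[OF i(2) i(4)]) (simp_all add: biv_sinh_eq_prim u v)
  have "(\<lambda>t. u t * biv_cosh u v t * biv_sinh v u t + biv_sinh u v t * (v t * biv_cosh v u t)) =
      (\<lambda>t. v t * biv_sinh u v t * biv_cosh v u t + biv_cosh u v t * (u t * biv_sinh v u t))"
    by (simp add: fun_eq_iff algebra_simps)
  then show ?thesis unfolding C S by simp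
qed

theorem theorem1:
  fixes f g h :: "real \<Rightarrow> complex"
  assumes "locally_integrable f" and "locally_integrable g" and "locally_integrable h"
  shows "(\<forall>i j. locally_abs_continuous (\<lambda>x. psi f g h x $ i $ j)) \<and>
         (\<forall>x. det (psi f g h x) = 1) \<and>
         (AE x in lebesgue.
            (psi f g h has_vector_derivative (coeff_matrix f g h x ** psi f g h x)) (at x)) \<and>
         psi f g h 0 = mat 1"
proof -
  note f = assms(1) and g = assms(2) and h = assms(3)
  define F where "F = (\<lambda>t. - exp (prim g t) * f t)"
  define H where "H = (\<lambda>t. exp (- prim g t) * h t)"
  have F: "locally_integrable F" and H: "locally_integrable H"
    unfolding F_def H_def
    by (intro locally_integrable_mult_continuous f h continuous_intros continuous_prim g)+
  define e1 where "e1 = (\<lambda>x. exp (prim g x / 2))"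
  define e2 where "e2 = (\<lambda>x. exp (- prim g x / 2))"
  \<comment> \<open>The exponentials in \<open>F\<close> and \<open>H\<close> are exactly those that
    turn one prefactor into the other, so that \<open>f\<close> and \<open>h\<close> reappear next
    to entries of the matrix.\<close>
  have e: "e1 x * e2 x = 1" "e1 x * H x = e2 x * h x" "e2 x * F x = - f x * e1 x" for x
    unfolding e1_def e2_def H_def F_def by (simp_all flip: exp_add mult.assoc)
  have psi: "psi f g h x = vector [vector [e1 x * biv_cosh F H x, e1 x * biv_sinh H F x],
      vector [e2 x * biv_sinh F H x, e2 x * biv_cosh H F x]]" for x
    unfolding psi_def Let_def F_def[symmetric] H_def[symmetric] e1_def e2_def by simp
  have i: "locally_integrable (\<lambda>t. H t * biv_sinh F H t)" "locally_integrable (\<lambda>t. F t * biv_cosh F H t)"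
    "locally_integrable (\<lambda>t. F t * biv_sinh H F t)" "locally_integrable (\<lambda>t. H t * biv_cosh H F t)"
    using locally_integrable_mult_continuous continuous_biv_cosh continuous_biv_sinh F H
    by (simp_all add: mult.commute)
  note eqs = biv_cosh_eq_prim[OF F H] biv_sinh_eq_prim[OF F H] biv_cosh_eq_prim[OF H F] biv_sinh_eq_prim[OF H F]
  have ce: "continuous_on UNIV e1" "continuous_on UNIV e2"
    unfolding e1_def e2_def by (intro continuous_intros continuous_prim g; simp)+
  have "locally_abs_continuous (\<lambda>x. exp (0 + c * prim g x))" for c
    by (intro locally_abs_continuous_exp locally_abs_continuous_affine locally_abs_continuous_prim g
        continuous_intros continuous_prim)
  from this[of "1/2"] this[of "-1/2"] have ace: "locally_abs_continuous e1" "locally_abs_continuous e2"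
    by (simp_all add: e1_def e2_def)
  have ac: "locally_abs_continuous \<phi>" if "\<And>x. \<phi> x = c + prim w x" "locally_integrable w" for \<phi> w c
  proof -
    have "\<phi> = (\<lambda>x. c + 1 * prim w x)" using that(1) by (simp add: fun_eq_iff)
    then show ?thesis
      using locally_abs_continuous_affine[OF locally_abs_continuous_prim[OF that(2)], of c 1] by simp
  qed
  have acC: "locally_abs_continuous (biv_cosh F H)" "locally_abs_continuous (biv_sinh F H)"
      "locally_abs_continuous (biv_cosh H F)" "locally_abs_continuous (biv_sinh H F)"
    by (rule ac[OF eqs(1) i(1)] ac[where c = 0, OF _ i(2)] ac[OF eqs(3) i(3)] ac[where c = 0, OF _ i(4)];
        simp add: eqs(2,4))+
  note cC = continuous_biv_cosh[OF F H] continuous_biv_sinh[OF F H] continuous_biv_cosh[OF H F] continuous_biv_sinh[OF H F]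
  have 1: "\<forall>i j. locally_abs_continuous (\<lambda>x. psi f g h x $ i $ j)"
    unfolding psi forall_2 by (simp add: locally_abs_continuous_mult ace ce acC cC)
  have 2: "det (psi f g h x) = 1" for x
  proof -
    have "det (psi f g h x) = (e1 x * e2 x) * (biv_cosh F H x * biv_cosh H F x - biv_sinh F H x * biv_sinh H F x)"
      unfolding psi det_2 by (simp add: algebra_simps)
    then show ?thesis by (simp add: e biv_cosh_sinh_identity F H)
  qed
  have "AE x in lebesgue. (prim g has_vector_derivative g x) (at x)"
    by (rule AE_prim_derivative[OF g])
  \<comment> \<open>Differentiability is needed for five primitives only, that of \<open>g\<close>
    and the four giving the hyperbolic functions; outside the union of their exceptional sets the
    product rule holds pointwise.\<close>
  with AE_prim_derivative[OF i(1)] AE_prim_derivative[OF i(2)] AE_prim_derivative[OF i(3)] AE_prim_derivative[OF i(4)]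
  have 3: "AE x in lebesgue. (psi f g h has_vector_derivative (coeff_matrix f g h x ** psi f g h x)) (at x)"
  proof eventually_elim
    case (elim x)
    have der: "(\<phi> has_vector_derivative w x) (at x)"
      if "(prim w has_vector_derivative w x) (at x)" "\<And>t. \<phi> t = c + prim w t" for \<phi> w c
    proof -
      have "\<phi> = (\<lambda>t. c + prim w t)" using that(2) by (rule ext)
      then show ?thesis using has_vector_derivative_add[OF has_vector_derivative_const that(1), of c] by simp
    qed
    have d: "((biv_cosh F H) has_vector_derivative H x * biv_sinh F H x) (at x)"
      "((biv_sinh F H) has_vector_derivative F x * biv_cosh F H x) (at x)"
      "((biv_cosh H F) has_vector_derivative F x * biv_sinh H F x) (at x)"
      "((biv_sinh H F) has_vector_derivative H x * biv_cosh H F x) (at x)"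
      by (rule der[OF elim(1) eqs(1)] der[OF elim(2), of _ 0] der[OF elim(3) eqs(3)] der[OF elim(4), of _ 0];
          simp only: eqs(2,4) add_0_left)+
    have "((\<lambda>t. exp (c * prim g t)) has_vector_derivative c * g x * exp (c * prim g x)) (at x)" for c
      using field_vector_diff_chain_at[of "\<lambda>t. c * prim g t" "c * g x" x exp "exp (c * prim g x)"] elim(5)
      by (auto simp: o_def intro!: derivative_intros)
    from this[of "1/2"] this[of "-1/2"]
    have de: "(e1 has_vector_derivative g x / 2 * e1 x) (at x)" "(e2 has_vector_derivative - g x / 2 * e2 x) (at x)"
      by (simp_all add: e1_def e2_def)
    have eF: "e1 x * (H x * z) = h x * (e2 x * z)" "e2 x * (F x * z) = - (f x * (e1 x * z))" for z
      using arg_cong[OF e(2)[of x], of "\<lambda>w. w * z"] arg_cong[OF e(3)[of x], of "\<lambda>w. w * z"]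
      by (simp_all add: mult_ac)
    note m = has_vector_derivative_eq_rhs[OF has_vector_derivative_mult]
    have m1: "((\<lambda>t. e1 t * biv_cosh F H t) has_vector_derivative
        g x / 2 * (e1 x * biv_cosh F H x) + h x * (e2 x * biv_sinh F H x)) (at x)"
      by (rule m[OF de(1) d(1)]) (simp only: eF, simp)
    have m2: "((\<lambda>t. e1 t * biv_sinh H F t) has_vector_derivative
        g x / 2 * (e1 x * biv_sinh H F x) + h x * (e2 x * biv_cosh H F x)) (at x)"
      by (rule m[OF de(1) d(4)]) (simp only: eF, simp)
    have m3: "((\<lambda>t. e2 t * biv_sinh F H t) has_vector_derivative
        - f x * (e1 x * biv_cosh F H x) + - g x / 2 * (e2 x * biv_sinh F H x)) (at x)"
      by (rule m[OF de(2) d(2)]) (simp only: eF, simp)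
    have m4: "((\<lambda>t. e2 t * biv_cosh H F t) has_vector_derivative
        - f x * (e1 x * biv_sinh H F x) + - g x / 2 * (e2 x * biv_cosh H F x)) (at x)"
      by (rule m[OF de(2) d(3)]) (simp only: eF, simp)
    show ?case
    \<comment> \<open>The componentwise criterion is used twice, since a matrix is a vector of
      rows.\<close>
    proof (intro has_vector_derivative_vec)
      fix i j
      show "((\<lambda>t. psi f g h t $ i $ j) has_vector_derivative (coeff_matrix f g h x ** psi f g h x) $ i $ j) (at x)"
        using m1 m2 m3 m4 exhaust_2[of i] exhaust_2[of j]
        unfolding psi matrix_matrix_mult_def coeff_matrix_def
        by (elim disjE) (simp_all add: sum_2)
    qed
  qed
  have "psi f g h 0 = mat 1"
    using eqs(1)[of 0] eqs(2)[of 0] eqs(3)[of 0] eqs(4)[of 0]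
    unfolding psi by (simp add: vec_eq_iff forall_2 mat_def e1_def e2_def)
  with 1 2 3 show ?thesis by blast
qed

end
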